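(* Let $M=(M,g)$ be a 6-dimensional Riemannian manifold. (a) If $M$ is Einstein, then the following curvature identity holds on $M$ (for all $i,j$): $$4\tau \overline{R}_{ij}+12\check{R}_{ij}+12\hat{R}_{ij}-24\mathring{R}_{ij}=(\tau \|R\|^2 -4\mathring{R}+2\hat{R})g_{ij}.$$ (b) If $M$ is super-Einstein, then the following curvature identity holds on $M$ (for all $i,j$): $$2\mathring{R}_{ij}-\hat{R}_{ij}=\frac{1}{6}(2\mathring{R}-\hat{R})g_{ij}.$$
   Context: Let $(M,g)$ be an $m$-dimensional Riemannian manifold with Levi-Civita connection $\nabla$. The curvature tensor is $R(X,Y)Z=[\nabla_X,\nabla_Y]Z-\nabla_{[X,Y]}Z$. The Ricci tensor is $\rho(X,Y)=\operatorname{Tr}(Z\mapsto R(Z,X)Y)$ and the scalar curvature is $\tau=\operatorname{Tr}\rho$. All components are taken with respect to a local orthonormal frame $\{e_i\}$, with summation over repeated indices, and $g_{ij}=g(e_i,e_j)=\delta_{ij}$. The components of the curvature tensor are $R_{ijkl}=g(R(e_i,e_j)e_k,e_l)$, so that $R_{1221}=k$ on a space of constant sectional curvature $k$ and $\rho_{ij}=R_{aija}$. Set $\|R\|^2=R_{abcd}R_{abcd}$ and $$\overline{R}_{ij}=R_{iabc}R_{jabc},\quad \check{R}_{ij}=R_{iuvj}R_{abcu}R_{abcv},\quad \hat{R}_{ij}=R_{ibcd}R_{jbuv}R_{cduv},\quad \mathring{R}_{ij}=R_{ibcd}R_{jucv}R_{budv},$$ $$\hat{R}= R_{abcd}R_{abuv}R_{cduv},\quad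 \mathring{R}=R_{abcd}R_{aucv}R_{budv}.$$ $M$ is Einstein if $\rho=\frac{\tau}{m}g$. An Einstein manifold $M$ is super-Einstein if $\overline{R}_{ij}=\frac{\|R\|^2}{m}g_{ij}$ with $\|R\|^2$ constant. *)

theory Defs
  imports "HOL-Analysis.Analysis"
begin

section \<open>Smooth maps on open sets of normed spaces\<close>

primrec diff_of_order_on ::
    "nat \<Rightarrow> 'a::real_normed_vector set \<Rightarrow> ('a \<Rightarrow> 'b::real_normed_vector) \<Rightarrow> bool" where
  "diff_of_order_on 0 S f \<longleftrightarrow> continuous_on S f"
| "diff_of_order_on (Suc k) S f \<longleftrightarrow>
     (\<forall>x\<in>S. f differentiable (at x)) \<and>
     (\<forall>v. diff_of_order_on k S (\<lambda>x. frechet_derivative f (at x) v))"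

text \<open>For open \<open>S\<close> in a finite-dimensional space, \<open>diff_of_order_on k S f\<close> says that \<open>f\<close> is of
  class \<open>C\<close> to the \<open>k\<close> on \<open>S\<close>; it is only used in that situation.\<close>

definition smooth_on :: "'a::real_normed_vector set \<Rightarrow> ('a \<Rightarrow> 'b::real_normed_vector) \<Rightarrow> bool" where
  "smooth_on S f \<longleftrightarrow> (\<forall>k. diff_of_order_on k S f)"


section \<open>Smooth manifolds\<close>

type_synonym ('a, 'n) chart = "'a set \<times> ('a \<Rightarrow> real ^ 'n)"

locale smooth_manifold =
  fixes M :: "'a topology" and A :: "('a, 'n::finite) chart set"
  assumes Hausdorff: "Hausdorff_space M"
    and second_countable: "second_countable M"
    and chart_openin: "(U, \<phi>) \<in> A \<Longrightarrow> openin M U"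
    and chart_open_image: "(U, \<phi>) \<in> A \<Longrightarrow> open (\<phi> ` U)"
    and chart_homeomorphic:
      "(U, \<phi>) \<in> A \<Longrightarrow> homeomorphic_map (subtopology M U) (top_of_set (\<phi> ` U)) \<phi>"
    and chart_cover: "(\<Union>(U, \<phi>)\<in>A. U) = topspace M"
    and chart_compatible:
      "(U, \<phi>) \<in> A \<Longrightarrow> (V, \<psi>) \<in> A \<Longrightarrow> smooth_on (\<phi> ` (U \<inter> V)) (\<psi> \<circ> inv_into U \<phi>)"

definition smooth_fun :: "('a, 'n::finite) chart set \<Rightarrow> 'a set \<Rightarrow> ('a \<Rightarrow> real) \<Rightarrow> bool" where
  "smooth_fun A W f \<longleftrightarrow> (\<forall>(U, \<phi>)\<in>A. smooth_on (\<phi> ` (U \<inter> W)) (f \<circ> inv_into U \<phi>))"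

definition smooth_near ::
    "'a topology \<Rightarrow> ('a, 'n::finite) chart set \<Rightarrow> 'a \<Rightarrow> ('a \<Rightarrow> real) \<Rightarrow> bool" where
  "smooth_near M A p f \<longleftrightarrow> (\<exists>W. openin M W \<and> p \<in> W \<and> smooth_fun A W f)"


section \<open>Tangent vectors and vector fields\<close>

text \<open>A tangent vector at \<open>p\<close> is a derivation on germs at \<open>p\<close> of smooth functions. It is encoded as a
  functional on total functions that depends only on the germ at \<open>p\<close>; the value 0 on functions
  that are not smooth near \<open>p\<close> makes the encoding unique.\<close>

type_synonym 'a tvec = "('a \<Rightarrow> real) \<Rightarrow> real"
type_synonym 'a vfield = "'a \<Rightarrow> 'a tvec"

definition tangent_space ::
    "'a topology \<Rightarrow> ('a, 'n::finite) chart set \<Rightarrow> 'a \<Rightarrow> 'a tvec set" where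
  "tangent_space M A p = {v.
     (\<forall>f h. smooth_near M A p f \<longrightarrow> smooth_near M A p h \<longrightarrow>
        v (\<lambda>x. f x + h x) = v f + v h \<and>
        v (\<lambda>x. f x * h x) = v f * h p + f p * v h) \<and>
     (\<forall>c f. smooth_near M A p f \<longrightarrow> v (\<lambda>x. c * f x) = c * v f) \<and>
     (\<forall>f h W. openin M W \<longrightarrow> p \<in> W \<longrightarrow> (\<forall>x\<in>W. f x = h x) \<longrightarrow> v f = v h) \<and>
     (\<forall>f. \<not> smooth_near M A p f \<longrightarrow> v f = 0)}"

definition tv_add :: "'a tvec \<Rightarrow> 'a tvec \<Rightarrow> 'a tvec" where
  "tv_add u v = (\<lambda>f. u f + v f)"

definition tv_scale :: "real \<Rightarrow> 'a tvec \<Rightarrow> 'a tvec" where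
  "tv_scale c v = (\<lambda>f. c * v f)"

definition vf_add :: "'a vfield \<Rightarrow> 'a vfield \<Rightarrow> 'a vfield" where
  "vf_add X Y = (\<lambda>p. tv_add (X p) (Y p))"

definition vf_scale :: "('a \<Rightarrow> real) \<Rightarrow> 'a vfield \<Rightarrow> 'a vfield" where
  "vf_scale h X = (\<lambda>p. tv_scale (h p) (X p))"

definition vf_diff :: "'a vfield \<Rightarrow> 'a vfield \<Rightarrow> 'a vfield" where
  "vf_diff X Y = vf_add X (vf_scale (\<lambda>_. -1) Y)"

text \<open>Smooth vector fields on an open set \<open>W\<close>; the values outside \<open>W\<close> are irrelevant.\<close>

definition vector_fields ::
    "'a topology \<Rightarrow> ('a, 'n::finite) chart set \<Rightarrow> 'a set \<Rightarrow> 'a vfield set" where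
  "vector_fields M A W = {X.
     (\<forall>p\<in>W. X p \<in> tangent_space M A p) \<and>
     (\<forall>V f. openin M V \<longrightarrow> V \<subseteq> W \<longrightarrow> smooth_fun A V f \<longrightarrow> smooth_fun A V (\<lambda>p. X p f))}"

definition lie_bracket ::
    "'a topology \<Rightarrow> ('a, 'n::finite) chart set \<Rightarrow> 'a vfield \<Rightarrow> 'a vfield \<Rightarrow> 'a vfield" where
  "lie_bracket M A X Y = (\<lambda>p f.
     if smooth_near M A p f then X p (\<lambda>q. Y q f) - Y p (\<lambda>q. X q f) else 0)"


section \<open>Riemannian metrics and the Levi-Civita connection\<close>

locale riemannian_manifold = smooth_manifold M A
  for M :: "'a topology" and A :: "('a, 'n::finite) chart set" +
  fixes g :: "'a \<Rightarrow> 'a tvec \<Rightarrow> 'a tvec \<Rightarrow> real"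
  assumes metric_sym:
      "\<lbrakk>p \<in> topspace M; u \<in> tangent_space M A p; v \<in> tangent_space M A p\<rbrakk> \<Longrightarrow> g p u v = g p v u"
    and metric_add:
      "\<lbrakk>p \<in> topspace M; u \<in> tangent_space M A p; v \<in> tangent_space M A p; w \<in> tangent_space M A p\<rbrakk>
       \<Longrightarrow> g p (tv_add u v) w = g p u w + g p v w"
    and metric_scale:
      "\<lbrakk>p \<in> topspace M; u \<in> tangent_space M A p; v \<in> tangent_space M A p\<rbrakk>
       \<Longrightarrow> g p (tv_scale c u) v = c * g p u v"
    and metric_pos:
      "\<lbrakk>p \<in> topspace M; v \<in> tangent_space M A p; v \<noteq> (\<lambda>_. 0)\<rbrakk> \<Longrightarrow> g p v v > 0"
    and metric_smooth:
      "\<lbrakk>openin M W; X \<in> vector_fields M A W; Y \<in> vector_fields M A W\<rbrakk>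
       \<Longrightarrow> smooth_fun A W (\<lambda>p. g p (X p) (Y p))"

text \<open>The connection \<open>D\<close> acts on vector fields defined on arbitrary open sets, compatibly with
  restriction (\<open>conn_local\<close>); \<open>D X Y\<close> is the covariant derivative of \<open>Y\<close> along \<open>X\<close>.\<close>

locale levi_civita = riemannian_manifold M A g
  for M :: "'a topology" and A :: "('a, 'n::finite) chart set"
    and g :: "'a \<Rightarrow> 'a tvec \<Rightarrow> 'a tvec \<Rightarrow> real" +
  fixes D :: "'a vfield \<Rightarrow> 'a vfield \<Rightarrow> 'a vfield"
  assumes conn_field:
      "\<lbrakk>openin M W; X \<in> vector_fields M A W; Y \<in> vector_fields M A W\<rbrakk>
       \<Longrightarrow> D X Y \<in> vector_fields M A W"
    and conn_local:
      "\<lbrakk>openin M W; X \<in> vector_fields M A W; X' \<in> vector_fields M A W;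
        Y \<in> vector_fields M A W; Y' \<in> vector_fields M A W;
        \<And>q. q \<in> W \<Longrightarrow> X q = X' q; \<And>q. q \<in> W \<Longrightarrow> Y q = Y' q; p \<in> W\<rbrakk>
       \<Longrightarrow> D X Y p = D X' Y' p"
    and conn_add_left:
      "\<lbrakk>openin M W; X \<in> vector_fields M A W; Y \<in> vector_fields M A W; Z \<in> vector_fields M A W; p \<in> W\<rbrakk>
       \<Longrightarrow> D (vf_add X Y) Z p = vf_add (D X Z) (D Y Z) p"
    and conn_scale_left:
      "\<lbrakk>openin M W; smooth_fun A W h; X \<in> vector_fields M A W; Y \<in> vector_fields M A W; p \<in> W\<rbrakk>
       \<Longrightarrow> D (vf_scale h X) Y p = vf_scale h (D X Y) p"
    and conn_add_right:
      "\<lbrakk>openin M W; X \<in> vector_fields M A W; Y \<in> vector_fields M A W; Z \<in> vector_fields M A W; p \<in> W\<rbrakk>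
       \<Longrightarrow> D X (vf_add Y Z) p = vf_add (D X Y) (D X Z) p"
    and conn_leibniz:
      "\<lbrakk>openin M W; smooth_fun A W h; X \<in> vector_fields M A W; Y \<in> vector_fields M A W; p \<in> W\<rbrakk>
       \<Longrightarrow> D X (vf_scale h Y) p = vf_add (vf_scale (\<lambda>q. X q h) Y) (vf_scale h (D X Y)) p"
    and torsion_free:
      "\<lbrakk>openin M W; X \<in> vector_fields M A W; Y \<in> vector_fields M A W; p \<in> W\<rbrakk>
       \<Longrightarrow> vf_diff (D X Y) (D Y X) p = lie_bracket M A X Y p"
    and metric_compatible:
      "\<lbrakk>openin M W; X \<in> vector_fields M A W; Y \<in> vector_fields M A W; Z \<in> vector_fields M A W; p \<in> W\<rbrakk>
       \<Longrightarrow> X p (\<lambda>q. g q (Y q) (Z q)) = g p (D X Y p) (Z p) + g p (Y p) (D X Z p)"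


section \<open>Curvature\<close>

definition curvature ::
    "'a topology \<Rightarrow> ('a, 'n::finite) chart set \<Rightarrow> ('a vfield \<Rightarrow> 'a vfield \<Rightarrow> 'a vfield) \<Rightarrow>
     'a vfield \<Rightarrow> 'a vfield \<Rightarrow> 'a vfield \<Rightarrow> 'a vfield" where
  "curvature M A D X Y Z =
     vf_diff (vf_diff (D X (D Y Z)) (D Y (D X Z))) (D (lie_bracket M A X Y) Z)"

definition orthonormal_frame ::
    "'a topology \<Rightarrow> ('a, 'n::finite) chart set \<Rightarrow> ('a \<Rightarrow> 'a tvec \<Rightarrow> 'a tvec \<Rightarrow> real) \<Rightarrow>
     'a set \<Rightarrow> ('n \<Rightarrow> 'a vfield) \<Rightarrow> bool" where
  "orthonormal_frame M A g W e \<longleftrightarrow>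
     openin M W \<and> (\<forall>i. e i \<in> vector_fields M A W) \<and>
     (\<forall>p\<in>W. \<forall>i j. g p (e i p) (e j p) = (if i = j then 1 else 0))"

definition curv_comp ::
    "'a topology \<Rightarrow> ('a, 'n::finite) chart set \<Rightarrow> ('a \<Rightarrow> 'a tvec \<Rightarrow> 'a tvec \<Rightarrow> real) \<Rightarrow>
     ('a vfield \<Rightarrow> 'a vfield \<Rightarrow> 'a vfield) \<Rightarrow> ('n \<Rightarrow> 'a vfield) \<Rightarrow> 'a \<Rightarrow>
     'n \<Rightarrow> 'n \<Rightarrow> 'n \<Rightarrow> 'n \<Rightarrow> real" where
  "curv_comp M A g D e p i j k l = g p (curvature M A D (e i) (e j) (e k) p) (e l p)"

text \<open>Traces over a tangent space are evaluated in an orthonormal frame \<open>e\<close>; as functions of the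
  point, \<open>ricci\<close> and \<open>scalar_curv\<close> do not depend on its choice.\<close>

definition ricci ::
    "'a topology \<Rightarrow> ('a, 'n::finite) chart set \<Rightarrow> ('a \<Rightarrow> 'a tvec \<Rightarrow> 'a tvec \<Rightarrow> real) \<Rightarrow>
     ('a vfield \<Rightarrow> 'a vfield \<Rightarrow> 'a vfield) \<Rightarrow> ('n \<Rightarrow> 'a vfield) \<Rightarrow>
     'a vfield \<Rightarrow> 'a vfield \<Rightarrow> 'a \<Rightarrow> real" where
  "ricci M A g D e X Y p = (\<Sum>a\<in>UNIV. g p (curvature M A D (e a) X Y p) (e a p))"

definition scalar_curv ::
    "'a topology \<Rightarrow> ('a, 'n::finite) chart set \<Rightarrow> ('a \<Rightarrow> 'a tvec \<Rightarrow> 'a tvec \<Rightarrow> real) \<Rightarrow>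
     ('a vfield \<Rightarrow> 'a vfield \<Rightarrow> 'a vfield) \<Rightarrow> ('n \<Rightarrow> 'a vfield) \<Rightarrow> 'a \<Rightarrow> real" where
  "scalar_curv M A g D e p = (\<Sum>a\<in>UNIV. ricci M A g D e (e a) (e a) p)"


section \<open>Quadratic and cubic contractions of a tensor with components \<open>R i j k l\<close>\<close>

type_synonym 'n tensor4 = "'n \<Rightarrow> 'n \<Rightarrow> 'n \<Rightarrow> 'n \<Rightarrow> real"

definition norm_sq :: "'n::finite tensor4 \<Rightarrow> real" where
  "norm_sq R = (\<Sum>a\<in>UNIV. \<Sum>b\<in>UNIV. \<Sum>c\<in>UNIV. \<Sum>d\<in>UNIV. R a b c d * R a b c d)"

definition R_bar :: "'n::finite tensor4 \<Rightarrow> 'n \<Rightarrow> 'n \<Rightarrow> real" where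
  "R_bar R i j = (\<Sum>a\<in>UNIV. \<Sum>b\<in>UNIV. \<Sum>c\<in>UNIV. R i a b c * R j a b c)"

definition R_check :: "'n::finite tensor4 \<Rightarrow> 'n \<Rightarrow> 'n \<Rightarrow> real" where
  "R_check R i j = (\<Sum>u\<in>UNIV. \<Sum>v\<in>UNIV. \<Sum>a\<in>UNIV. \<Sum>b\<in>UNIV. \<Sum>c\<in>UNIV.
     R i u v j * R a b c u * R a b c v)"

definition R_hat :: "'n::finite tensor4 \<Rightarrow> 'n \<Rightarrow> 'n \<Rightarrow> real" where
  "R_hat R i j = (\<Sum>b\<in>UNIV. \<Sum>c\<in>UNIV. \<Sum>d\<in>UNIV. \<Sum>u\<in>UNIV. \<Sum>v\<in>UNIV.
     R i b c d * R j b u v * R c d u v)"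

definition R_ring :: "'n::finite tensor4 \<Rightarrow> 'n \<Rightarrow> 'n \<Rightarrow> real" where
  "R_ring R i j = (\<Sum>b\<in>UNIV. \<Sum>c\<in>UNIV. \<Sum>d\<in>UNIV. \<Sum>u\<in>UNIV. \<Sum>v\<in>UNIV.
     R i b c d * R j u c v * R b u d v)"

definition R_hat_scalar :: "'n::finite tensor4 \<Rightarrow> real" where
  "R_hat_scalar R = (\<Sum>a\<in>UNIV. \<Sum>b\<in>UNIV. \<Sum>c\<in>UNIV. \<Sum>d\<in>UNIV. \<Sum>u\<in>UNIV. \<Sum>v\<in>UNIV.
     R a b c d * R a b u v * R c d u v)"

definition R_ring_scalar :: "'n::finite tensor4 \<Rightarrow> real" where
  "R_ring_scalar R = (\<Sum>a\<in>UNIV. \<Sum>b\<in>UNIV. \<Sum>c\<in>UNIV. \<Sum>d\<in>UNIV. \<Sum>u\<in>UNIV. \<Sum>v\<in>UNIV.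
     R a b c d * R a u c v * R b u d v)"


section \<open>Einstein and super-Einstein manifolds\<close>

definition einstein ::
    "'a topology \<Rightarrow> ('a, 'n::finite) chart set \<Rightarrow> ('a \<Rightarrow> 'a tvec \<Rightarrow> 'a tvec \<Rightarrow> real) \<Rightarrow>
     ('a vfield \<Rightarrow> 'a vfield \<Rightarrow> 'a vfield) \<Rightarrow> bool" where
  "einstein M A g D \<longleftrightarrow>
     (\<forall>W e X Y p. orthonormal_frame M A g W e \<longrightarrow>
        X \<in> vector_fields M A W \<longrightarrow> Y \<in> vector_fields M A W \<longrightarrow> p \<in> W \<longrightarrow>
        ricci M A g D e X Y p = scalar_curv M A g D e p / real CARD('n) * g p (X p) (Y p))"

definition super_einstein ::
    "'a topology \<Rightarrow> ('a, 'n::finite) chart set \<Rightarrow> ('a \<Rightarrow> 'a tvec \<Rightarrow> 'a tvec \<Rightarrow> real) \<Rightarrow>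
     ('a vfield \<Rightarrow> 'a vfield \<Rightarrow> 'a vfield) \<Rightarrow> bool" where
  "super_einstein M A g D \<longleftrightarrow>
     einstein M A g D \<and>
     (\<forall>W e p i j. orthonormal_frame M A g W e \<longrightarrow> p \<in> W \<longrightarrow>
        R_bar (curv_comp M A g D e p) i j
          = norm_sq (curv_comp M A g D e p) / real CARD('n) * g p (e i p) (e j p)) \<and>
     (\<exists>c. \<forall>W e p. orthonormal_frame M A g W e \<longrightarrow> p \<in> W \<longrightarrow>
        norm_sq (curv_comp M A g D e p) = c)"

end

theory Submission
  imports Defs
begin

text \<open>Over a six-element index set every antisymmetrisation over seven indices vanishes. Apply this to
  the cube of a trace-free curvature tensor \<open>W\<close> times a covector and contract six index pairs: the
  remaining two-tensor is a multiple of the metric. All terms with a self-contraction of \<open>W\<close> drop out,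
  and the first Bianchi identity brings the others to the form
  \<open>4 * R_check + 4 * R_hat - 8 * R_ring\<close>. At each point, the curvature tensor of an Einstein metric is
  such a \<open>W\<close> plus a multiple \<open>k\<close> of the curvature of the unit sphere; expanding the cubic
  contractions in \<open>k\<close> gives (a). In the super-Einstein case \<open>R_check\<close> is itself a multiple of the
  metric, and (a) reduces to (b).\<close>

section \<open>Vector fields and the Jacobi identity\<close>

text \<open>Up to a factor, the contracted seven-index antisymmetriser is the third Lovelock tensor,
  whose scalar counterpart is the Gauss-Bonnet integrand of dimension six; its pointwise vanishing
  in this dimension is the source of the identity. What enters is the algebra of the curvature at a
  point, but the definitions provide a connection on fields of derivations. Skew-symmetry and the
  Bianchi identity must therefore be derived first, the latter from the Jacobi identity. For a
  general curvature tensor the contraction produces many Ricci terms. The Einstein condition removes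
  the trace-free Ricci part, so all of them are carried by the single number \<open>k\<close> and
  can be restored by expanding in its powers. A sum over 5040 permutations is avoided:
  \<open>W\<close> is a two-form in its last two slots, so 7 * 15 * 6 = 630 shuffle terms express
  the antisymmetrisation. It vanishes by its sign changes under adjacent transpositions and the
  pigeonhole principle.\<close>

lemma diff_of_order_on_subset:
  assumes "diff_of_order_on k S f" "T \<subseteq> S"
  shows "diff_of_order_on k T f"
  using assms
proof (induction k arbitrary: f)
  case 0
  then show ?case by (simp add: continuous_on_subset)
next
  case (Suc k)
  then show ?case by (auto simp: subset_iff)
qed

lemma frechet_derivative_cong_open:
  assumes "open S" "x \<in> S" "\<And>y. y \<in> S \<Longrightarrow> f y = h y"
  shows "f differentiable (at x) \<longleftrightarrow> h differentiable (at x)"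
    and "frechet_derivative f (at x) = frechet_derivative h (at x)"
proof -
  have *: "(f has_derivative F) (at x) \<longleftrightarrow> (h has_derivative F) (at x)" for F
    using has_derivative_transform_within_open[of f F x UNIV S h]
      has_derivative_transform_within_open[of h F x UNIV S f] assms by auto
  show "f differentiable (at x) \<longleftrightarrow> h differentiable (at x)"
    by (simp add: differentiable_def *)
  show "frechet_derivative f (at x) = frechet_derivative h (at x)"
    by (simp add: frechet_derivative_def *)
qed

text \<open>The derivatives are taken in the full space, so agreement on \<open>S\<close> must give
  agreement near each of its points; this is where openness enters.\<close>

lemma diff_of_order_on_cong:
  assumes "open S" "\<And>y. y \<in> S \<Longrightarrow> f y = h y" "diff_of_order_on k S f"
  shows "diff_of_order_on k S h"
  using assms(2,3)
proof (induction k arbitrary: f h)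
  case 0
  then show ?case using continuous_on_cong[of S S f h] by simp
next
  case (Suc k)
  note cong = frechet_derivative_cong_open[OF \<open>open S\<close> _ Suc.prems(1)]
  have d: "f differentiable (at x)" if "x \<in> S" for x
    using Suc.prems(2) that by simp
  have "diff_of_order_on k S (\<lambda>x. frechet_derivative h (at x) v)" for v
  proof (rule Suc.IH)
    show "frechet_derivative f (at x) v = frechet_derivative h (at x) v" if "x \<in> S" for x
      by (simp only: cong(2)[OF that])
    show "diff_of_order_on k S (\<lambda>x. frechet_derivative f (at x) v)"
      using Suc.prems(2) by simp
  qed
  moreover have "h differentiable (at x)" if "x \<in> S" for x
    using cong(1)[OF that] d[OF that] by simp
  ultimately show ?case by simp
qed

text \<open>In the product rule each factor also appears undifferentiated, so a factor of order
  \<open>Suc k\<close> must be available at order \<open>k\<close>.\<close>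

lemma diff_of_order_on_SucD: "diff_of_order_on (Suc k) S f \<Longrightarrow> diff_of_order_on k S f"
proof (induction k arbitrary: f)
  case 0
  then have "continuous (at x within S) f" if "x \<in> S" for x
    using that by (simp add: differentiable_imp_continuous_within differentiable_at_withinI)
  then show ?case by (simp add: continuous_on_eq_continuous_within)
next
  case (Suc k)
  then show ?case by simp
qed

lemma diff_of_order_on_add:
  assumes "open S" "diff_of_order_on k S f" "diff_of_order_on k S h"
  shows "diff_of_order_on k S (\<lambda>x. f x + h x)"
  using assms(2,3)
proof (induction k arbitrary: f h)
  case 0
  then show ?case by (auto intro: continuous_on_add)
next
  case (Suc k)
  have "diff_of_order_on k S (\<lambda>x. frechet_derivative (\<lambda>x. f x + h x) (at x) v)" for v
  proof (rule diff_of_order_on_cong[OF \<open>open S\<close> _ Suc.IH])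
    show "frechet_derivative f (at x) v + frechet_derivative h (at x) v
        = frechet_derivative (\<lambda>x. f x + h x) (at x) v" if "x \<in> S" for x
    proof -
      have "((\<lambda>x. f x + h x) has_derivative
          (\<lambda>v. frechet_derivative f (at x) v + frechet_derivative h (at x) v)) (at x)"
        using Suc.prems that by (intro has_derivative_add) (auto simp: frechet_derivative_works)
      then show ?thesis by (rule fun_cong[OF frechet_derivative_at, of _ _ _ v])
    qed
  qed (use Suc.prems in auto)
  then show ?case using Suc.prems by (auto intro: differentiable_add)
qed

lemma diff_of_order_on_mult:
  fixes f h :: "'a::real_normed_vector \<Rightarrow> real"
  assumes "open S" "diff_of_order_on k S f" "diff_of_order_on k S h"
  shows "diff_of_order_on k S (\<lambda>x. f x * h x)"
  using assms(2,3)
proof (induction k arbitrary: f h)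
  case 0
  then show ?case by (auto intro: continuous_on_mult)
next
  case (Suc k)
  have "diff_of_order_on k S (\<lambda>x. frechet_derivative (\<lambda>x. f x * h x) (at x) v)" for v
  proof (rule diff_of_order_on_cong[OF \<open>open S\<close> _ diff_of_order_on_add[OF \<open>open S\<close> Suc.IH Suc.IH]])
    show "f x * frechet_derivative h (at x) v + frechet_derivative f (at x) v * h x
        = frechet_derivative (\<lambda>x. f x * h x) (at x) v" if "x \<in> S" for x
    proof -
      have "((\<lambda>x. f x * h x) has_derivative
          (\<lambda>v. f x * frechet_derivative h (at x) v + frechet_derivative f (at x) v * h x)) (at x)"
        using Suc.prems that by (intro has_derivative_mult) (auto simp: frechet_derivative_works)
      then show ?thesis by (rule fun_cong[OF frechet_derivative_at, of _ _ _ v])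
    qed
  qed (use Suc.prems diff_of_order_on_SucD[of k S] in \<open>simp_all\<close>)
  then show ?case using Suc.prems by (auto intro: differentiable_mult)
qed

lemma diff_of_order_on_const: "diff_of_order_on k S (\<lambda>_. c)"
  by (induction k arbitrary: c) (auto simp: frechet_derivative_const)

section \<open>Smooth functions, tangent vectors and vector fields on a manifold\<close>

context smooth_manifold
begin

lemma chart_subset: "(U, \<phi>) \<in> A \<Longrightarrow> U \<subseteq> topspace M"
  using chart_openin openin_subset by blast

lemma chart_inv:
  assumes "(U, \<phi>) \<in> A" "x \<in> U"
  shows "inv_into U \<phi> (\<phi> x) = x"
proof -
  have "inj_on \<phi> (topspace (subtopology M U))"
    using chart_homeomorphic[OF assms(1)] homeomorphic_eq_everything_map by blast
  then show ?thesis using assms chart_subset[OF assms(1)]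
    by (simp add: inf_absorb2)
qed

lemma open_chart_image:
  assumes "(U, \<phi>) \<in> A" "openin M W"
  shows "open (\<phi> ` (U \<inter> W))"
proof -
  have "open_map (subtopology M U) (top_of_set (\<phi> ` U)) \<phi>"
    using chart_homeomorphic[OF assms(1)] homeomorphic_eq_everything_map by blast
  moreover have "openin (subtopology M U) (U \<inter> W)"
    using assms(2) by (metis openin_subtopology_Int2)
  ultimately have "openin (top_of_set (\<phi> ` U)) (\<phi> ` (U \<inter> W))"
    by (simp add: open_map_def)
  then show ?thesis using chart_open_image[OF assms(1)] openin_open_trans by blast
qed

lemma smooth_fun_iff:
  "smooth_fun A W f \<longleftrightarrow>
     (\<forall>U \<phi> k. (U, \<phi>) \<in> A \<longrightarrow> diff_of_order_on k (\<phi> ` (U \<inter> W)) (\<lambda>x. f (inv_into U \<phi> x)))"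
  by (auto simp: smooth_fun_def smooth_on_def o_def)

lemma smooth_fun_mono:
  assumes "smooth_fun A W f" "V \<subseteq> W"
  shows "smooth_fun A V f"
  unfolding smooth_fun_iff
proof (intro allI impI)
  fix U \<phi> k assume "(U, \<phi>) \<in> A"
  then have "diff_of_order_on k (\<phi> ` (U \<inter> W)) (\<lambda>x. f (inv_into U \<phi> x))"
    using assms(1) by (simp add: smooth_fun_iff)
  then show "diff_of_order_on k (\<phi> ` (U \<inter> V)) (\<lambda>x. f (inv_into U \<phi> x))"
    by (rule diff_of_order_on_subset) (use assms(2) in blast)
qed

lemma smooth_fun_cong:
  assumes "openin M W" "smooth_fun A W f" "\<And>x. x \<in> W \<Longrightarrow> f x = h x"
  shows "smooth_fun A W h"
  unfolding smooth_fun_iff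
proof (intro allI impI)
  fix U \<phi> k assume c: "(U, \<phi>) \<in> A"
  show "diff_of_order_on k (\<phi> ` (U \<inter> W)) (\<lambda>x. h (inv_into U \<phi> x))"
  proof (rule diff_of_order_on_cong[OF open_chart_image[OF c assms(1)]])
    show "diff_of_order_on k (\<phi> ` (U \<inter> W)) (\<lambda>x. f (inv_into U \<phi> x))"
      using assms(2) c by (simp add: smooth_fun_iff)
    fix y assume "y \<in> \<phi> ` (U \<inter> W)"
    then obtain x where x: "x \<in> U" "x \<in> W" "y = \<phi> x" by blast
    show "f (inv_into U \<phi> y) = h (inv_into U \<phi> y)"
      by (simp only: x(3) chart_inv[OF c x(1)] assms(3)[OF x(2)])
  qed
qed

lemma smooth_fun_add:
  "openin M W \<Longrightarrow> smooth_fun A W f \<Longrightarrow> smooth_fun A W h \<Longrightarrow> smooth_fun A W (\<lambda>x. f x + h x)"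
  by (simp add: smooth_fun_iff diff_of_order_on_add open_chart_image)

lemma smooth_fun_mult:
  "openin M W \<Longrightarrow> smooth_fun A W f \<Longrightarrow> smooth_fun A W h \<Longrightarrow> smooth_fun A W (\<lambda>x. f x * h x)"
  by (simp add: smooth_fun_iff diff_of_order_on_mult open_chart_image)

lemma smooth_fun_const: "smooth_fun A W (\<lambda>_. c)"
  by (simp add: smooth_fun_iff diff_of_order_on_const)

lemma smooth_fun_diff:
  assumes "openin M W" "smooth_fun A W f" "smooth_fun A W h"
  shows "smooth_fun A W (\<lambda>x. f x - h x)"
  using smooth_fun_add[OF assms(1,2) smooth_fun_mult[OF assms(1) smooth_fun_const[of W "-1"] assms(3)]]
  by simp

lemma smooth_nearI: "smooth_fun A W f \<Longrightarrow> openin M W \<Longrightarrow> p \<in> W \<Longrightarrow> smooth_near M A p f"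
  by (auto simp: smooth_near_def)

text \<open>With this the case distinction in \<open>lie_bracket\<close> depends on the germ
  only.\<close>

lemma smooth_near_cong:
  assumes "openin M W" "p \<in> W" "\<And>x. x \<in> W \<Longrightarrow> f x = h x"
  shows "smooth_near M A p f \<longleftrightarrow> smooth_near M A p h"
proof -
  have "smooth_near M A p h'" if s: "smooth_near M A p f'" and eq: "\<And>x. x \<in> W \<Longrightarrow> f' x = h' x" for f' h'
  proof -
    obtain V where V: "openin M V" "p \<in> V" "smooth_fun A V f'"
      using s by (auto simp: smooth_near_def)
    have "smooth_fun A (V \<inter> W) h'"
    proof (rule smooth_fun_cong)
      show "smooth_fun A (V \<inter> W) f'"
        using smooth_fun_mono[OF V(3)] by simp
    qed (use V assms(1) eq in auto)
    then show ?thesis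
      using V assms by (intro smooth_nearI[of "V \<inter> W"]) auto
  qed
  then show ?thesis using assms(3) by metis
qed

lemma tangent_space_add:
  "v \<in> tangent_space M A p \<Longrightarrow> smooth_near M A p f \<Longrightarrow> smooth_near M A p h
   \<Longrightarrow> v (\<lambda>x. f x + h x) = v f + v h"
  by (simp add: tangent_space_def)

lemma tangent_space_mult:
  "v \<in> tangent_space M A p \<Longrightarrow> smooth_near M A p f \<Longrightarrow> smooth_near M A p h
   \<Longrightarrow> v (\<lambda>x. f x * h x) = v f * h p + f p * v h"
  by (simp add: tangent_space_def)

lemma tangent_space_scale:
  "v \<in> tangent_space M A p \<Longrightarrow> smooth_near M A p f \<Longrightarrow> v (\<lambda>x. c * f x) = c * v f"
  by (simp add: tangent_space_def)

lemma tangent_space_local: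
  "v \<in> tangent_space M A p \<Longrightarrow> openin M W \<Longrightarrow> p \<in> W \<Longrightarrow> (\<And>x. x \<in> W \<Longrightarrow> f x = h x) \<Longrightarrow> v f = v h"
  by (simp add: tangent_space_def)

lemma tangent_space_nonsmooth:
  "v \<in> tangent_space M A p \<Longrightarrow> \<not> smooth_near M A p f \<Longrightarrow> v f = 0"
  by (simp add: tangent_space_def)

lemma smooth_near_scale:
  assumes "smooth_near M A p f"
  shows "smooth_near M A p (\<lambda>x. c * f x)"
proof -
  obtain W where W: "openin M W" "p \<in> W" "smooth_fun A W f"
    using assms by (auto simp: smooth_near_def)
  show ?thesis
    by (rule smooth_nearI[OF smooth_fun_mult[OF W(1) smooth_fun_const W(3)] W(1,2)])
qed

lemma tangent_space_diff:
  assumes "v \<in> tangent_space M A p" "smooth_near M A p f" "smooth_near M A p h"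
  shows "v (\<lambda>x. f x - h x) = v f - v h"
  using tangent_space_add[OF assms(1,2) smooth_near_scale[OF assms(3), of "-1"]]
    tangent_space_scale[OF assms(1,3), of "-1"] by simp

lemma tangent_spaceI:
  assumes "\<And>f h. smooth_near M A p f \<Longrightarrow> smooth_near M A p h \<Longrightarrow> v (\<lambda>x. f x + h x) = v f + v h"
    and "\<And>f h. smooth_near M A p f \<Longrightarrow> smooth_near M A p h \<Longrightarrow> v (\<lambda>x. f x * h x) = v f * h p + f p * v h"
    and "\<And>c f. smooth_near M A p f \<Longrightarrow> v (\<lambda>x. c * f x) = c * v f"
    and "\<And>f h W. openin M W \<Longrightarrow> p \<in> W \<Longrightarrow> \<forall>x\<in>W. f x = h x \<Longrightarrow> v f = v h"
    and "\<And>f. \<not> smooth_near M A p f \<Longrightarrow> v f = 0"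
  shows "v \<in> tangent_space M A p"
  unfolding tangent_space_def mem_Collect_eq using assms by blast

lemma tv_add_tangent:
  assumes "u \<in> tangent_space M A p" "v \<in> tangent_space M A p"
  shows "tv_add u v \<in> tangent_space M A p"
proof (rule tangent_spaceI)
  fix f h :: "'a \<Rightarrow> real" and W assume "openin M W" "p \<in> W" "\<forall>x\<in>W. f x = h x"
  then show "tv_add u v f = tv_add u v h"
    using tangent_space_local[OF assms(1), of W f h] tangent_space_local[OF assms(2), of W f h]
    by (simp add: tv_add_def)
qed (simp_all add: tv_add_def tangent_space_add[OF assms(1)] tangent_space_add[OF assms(2)]
    tangent_space_mult[OF assms(1)] tangent_space_mult[OF assms(2)]
    tangent_space_scale[OF assms(1)] tangent_space_scale[OF assms(2)]
    tangent_space_nonsmooth[OF assms(1)] tangent_space_nonsmooth[OF assms(2)] algebra_simps)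

lemma tv_scale_tangent:
  assumes "v \<in> tangent_space M A p"
  shows "tv_scale c v \<in> tangent_space M A p"
proof (rule tangent_spaceI)
  fix f h :: "'a \<Rightarrow> real" and W assume "openin M W" "p \<in> W" "\<forall>x\<in>W. f x = h x"
  then show "tv_scale c v f = tv_scale c v h"
    using tangent_space_local[OF assms, of W f h] by (simp add: tv_scale_def)
qed (simp_all add: tv_scale_def tangent_space_add[OF assms] tangent_space_mult[OF assms]
    tangent_space_scale[OF assms] tangent_space_nonsmooth[OF assms] algebra_simps)

lemma vector_field_at: "X \<in> vector_fields M A W \<Longrightarrow> p \<in> W \<Longrightarrow> X p \<in> tangent_space M A p"
  by (simp add: vector_fields_def)

lemma vector_field_smooth:
  "X \<in> vector_fields M A W \<Longrightarrow> openin M V \<Longrightarrow> V \<subseteq> W \<Longrightarrow> smooth_fun A V f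
   \<Longrightarrow> smooth_fun A V (\<lambda>p. X p f)"
  by (simp add: vector_fields_def)

lemma vector_fieldsI:
  assumes "\<And>p. p \<in> W \<Longrightarrow> X p \<in> tangent_space M A p"
    and "\<And>V f. openin M V \<Longrightarrow> V \<subseteq> W \<Longrightarrow> smooth_fun A V f \<Longrightarrow> smooth_fun A V (\<lambda>p. X p f)"
  shows "X \<in> vector_fields M A W"
  unfolding vector_fields_def using assms by blast

lemma vf_add_field:
  assumes "X \<in> vector_fields M A W" "Y \<in> vector_fields M A W"
  shows "vf_add X Y \<in> vector_fields M A W"
proof (rule vector_fieldsI)
  fix V f assume V: "openin M V" "V \<subseteq> W" "smooth_fun A V f"
  show "smooth_fun A V (\<lambda>p. vf_add X Y p f)"
    unfolding vf_add_def tv_add_def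
    by (rule smooth_fun_add[OF V(1) vector_field_smooth[OF assms(1) V] vector_field_smooth[OF assms(2) V]])
qed (simp add: vf_add_def tv_add_tangent vector_field_at[OF assms(1)] vector_field_at[OF assms(2)])

lemma vf_scale_field:
  assumes "smooth_fun A W h" "X \<in> vector_fields M A W"
  shows "vf_scale h X \<in> vector_fields M A W"
proof (rule vector_fieldsI)
  fix V f assume V: "openin M V" "V \<subseteq> W" "smooth_fun A V f"
  show "smooth_fun A V (\<lambda>p. vf_scale h X p f)"
    unfolding vf_scale_def tv_scale_def
    by (rule smooth_fun_mult[OF V(1) smooth_fun_mono[OF assms(1) V(2)] vector_field_smooth[OF assms(2) V]])
qed (simp add: vf_scale_def tv_scale_tangent vector_field_at[OF assms(2)])

lemma vf_diff_field:
  "X \<in> vector_fields M A W \<Longrightarrow> Y \<in> vector_fields M A W \<Longrightarrow> vf_diff X Y \<in> vector_fields M A W"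
  unfolding vf_diff_def by (intro vf_add_field vf_scale_field smooth_fun_const)

lemma lie_bracket_apply:
  "smooth_near M A p f \<Longrightarrow> lie_bracket M A X Y p f = X p (\<lambda>q. Y q f) - Y p (\<lambda>q. X q f)"
  by (simp add: lie_bracket_def)

lemma smooth_near_common:
  assumes "openin M W" "p \<in> W" "smooth_near M A p f" "smooth_near M A p h"
  obtains V where "openin M V" "p \<in> V" "V \<subseteq> W" "smooth_fun A V f" "smooth_fun A V h"
proof -
  obtain V1 V2 where "openin M V1" "p \<in> V1" "smooth_fun A V1 f"
    and "openin M V2" "p \<in> V2" "smooth_fun A V2 h"
    using assms(3,4) by (auto simp: smooth_near_def)
  then show ?thesis
    using assms(1,2) smooth_fun_mono[of V1 f "W \<inter> V1 \<inter> V2"] smooth_fun_mono[of V2 h "W \<inter> V1 \<inter> V2"]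
    by (intro that[of "W \<inter> V1 \<inter> V2"]) auto
qed

section \<open>Second derivatives along fields and the Lie bracket\<close>

lemma second_derivative_add:
  assumes X: "X \<in> vector_fields M A W" and Y: "Y \<in> vector_fields M A W"
    and V: "openin M V" "V \<subseteq> W" "p \<in> V" "smooth_fun A V f" "smooth_fun A V h"
  shows "X p (\<lambda>q. Y q (\<lambda>x. f x + h x)) = X p (\<lambda>q. Y q f) + X p (\<lambda>q. Y q h)"
proof -
  have p: "X p \<in> tangent_space M A p" using X V vector_field_at by blast
  have "X p (\<lambda>q. Y q (\<lambda>x. f x + h x)) = X p (\<lambda>q. Y q f + Y q h)"
    using V Y by (intro tangent_space_local[OF p, of V] tangent_space_add)
      (auto intro: vector_field_at smooth_nearI)
  also have "\<dots> = X p (\<lambda>q. Y q f) + X p (\<lambda>q. Y q h)"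
    using V Y by (intro tangent_space_add[OF p] smooth_nearI[of V] vector_field_smooth[of Y W]) auto
  finally show ?thesis .
qed

lemma second_derivative_scale:
  assumes X: "X \<in> vector_fields M A W" and Y: "Y \<in> vector_fields M A W"
    and V: "openin M V" "V \<subseteq> W" "p \<in> V" "smooth_fun A V f"
  shows "X p (\<lambda>q. Y q (\<lambda>x. c * f x)) = c * X p (\<lambda>q. Y q f)"
proof -
  have p: "X p \<in> tangent_space M A p" using X V vector_field_at by blast
  have "X p (\<lambda>q. Y q (\<lambda>x. c * f x)) = X p (\<lambda>q. c * Y q f)"
    using V Y by (intro tangent_space_local[OF p, of V] tangent_space_scale)
      (auto intro: vector_field_at smooth_nearI)
  also have "\<dots> = c * X p (\<lambda>q. Y q f)"
    using V Y by (intro tangent_space_scale[OF p] smooth_nearI[of V] vector_field_smooth[of Y W]) auto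
  finally show ?thesis .
qed

text \<open>The two mixed first-order products are together symmetric in \<open>X\<close> and
  \<open>Y\<close>. They cancel in the commutator, which is why the bracket is a derivation.\<close>

lemma second_derivative_mult:
  assumes X: "X \<in> vector_fields M A W" and Y: "Y \<in> vector_fields M A W"
    and V: "openin M V" "V \<subseteq> W" "p \<in> V" "smooth_fun A V f" "smooth_fun A V h"
  shows "X p (\<lambda>q. Y q (\<lambda>x. f x * h x))
    = X p (\<lambda>q. Y q f) * h p + Y p f * X p h + X p f * Y p h + f p * X p (\<lambda>q. Y q h)"
proof -
  have p: "X p \<in> tangent_space M A p" using X V vector_field_at by blast
  have Yf: "smooth_fun A V (\<lambda>q. Y q f)" and Yh: "smooth_fun A V (\<lambda>q. Y q h)"
    using V Y vector_field_smooth by blast+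
  note sn = smooth_nearI[OF _ V(1,3)]
  have "X p (\<lambda>q. Y q (\<lambda>x. f x * h x)) = X p (\<lambda>q. Y q f * h q + f q * Y q h)"
    using V Y by (intro tangent_space_local[OF p, of V] tangent_space_mult)
      (auto intro: vector_field_at smooth_nearI)
  also have "\<dots> = X p (\<lambda>q. Y q f * h q) + X p (\<lambda>q. f q * Y q h)"
    using V Yf Yh by (intro tangent_space_add[OF p] sn smooth_fun_mult) auto
  also have "\<dots> = X p (\<lambda>q. Y q f) * h p + Y p f * X p h + X p f * Y p h + f p * X p (\<lambda>q. Y q h)"
    using tangent_space_mult[OF p sn[OF Yf] sn[OF V(5)]] tangent_space_mult[OF p sn[OF V(4)] sn[OF Yh]]
    by simp
  finally show ?thesis .
qed

lemma lie_bracket_field: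
  assumes W: "openin M W" and X: "X \<in> vector_fields M A W" and Y: "Y \<in> vector_fields M A W"
  shows "lie_bracket M A X Y \<in> vector_fields M A W"
proof -
  have "lie_bracket M A X Y p \<in> tangent_space M A p" if p: "p \<in> W" for p
  proof (rule tangent_spaceI)
    fix f h assume f: "smooth_near M A p f" and h: "smooth_near M A p h"
    obtain V where V: "openin M V" "p \<in> V" "V \<subseteq> W" "smooth_fun A V f" "smooth_fun A V h"
      using smooth_near_common[OF W p f h] .
    have "smooth_near M A p (\<lambda>x. f x + h x)" "smooth_near M A p (\<lambda>x. f x * h x)"
      using V by (auto intro: smooth_nearI smooth_fun_add smooth_fun_mult)
    with f h show "lie_bracket M A X Y p (\<lambda>x. f x + h x) = lie_bracket M A X Y p f + lie_bracket M A X Y p h"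
      "lie_bracket M A X Y p (\<lambda>x. f x * h x) = lie_bracket M A X Y p f * h p + f p * lie_bracket M A X Y p h"
      using second_derivative_add[OF X Y V(1,3,2,4,5)] second_derivative_add[OF Y X V(1,3,2,4,5)]
        second_derivative_mult[OF X Y V(1,3,2,4,5)] second_derivative_mult[OF Y X V(1,3,2,4,5)]
      by (simp_all add: lie_bracket_apply algebra_simps)
  next
    fix c f assume f: "smooth_near M A p f"
    obtain V where V: "openin M V" "p \<in> V" "V \<subseteq> W" "smooth_fun A V f"
      using smooth_near_common[OF W p f f] by metis
    show "lie_bracket M A X Y p (\<lambda>x. c * f x) = c * lie_bracket M A X Y p f"
      using second_derivative_scale[OF X Y V(1,3,2,4)] second_derivative_scale[OF Y X V(1,3,2,4)]
        f smooth_near_scale[OF f]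
      by (simp add: lie_bracket_apply algebra_simps)
  next
    fix f h :: "'a \<Rightarrow> real" and V assume V: "openin M V" "p \<in> V" "\<forall>x\<in>V. f x = h x"
    \<comment> \<open>The outer derivation at \<open>p\<close> sees the inner function on a
      neighbourhood, so the inner values must agree at all nearby points of \<open>V\<close> that
      lie in \<open>W\<close>, where \<open>Z'\<close> is tangent.\<close>
    have *: "Z p (\<lambda>q. Z' q f) = Z p (\<lambda>q. Z' q h)"
      if Z: "Z \<in> vector_fields M A W" and Z': "Z' \<in> vector_fields M A W" for Z Z'
    proof (rule tangent_space_local[OF vector_field_at[OF Z p] openin_Int[OF V(1) W]])
      fix q assume q: "q \<in> V \<inter> W"
      show "Z' q f = Z' q h"
        by (rule tangent_space_local[OF vector_field_at[OF Z'] V(1)]) (use q V(3) in blast)+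
    qed (use V(2) p in blast)
    show "lie_bracket M A X Y p f = lie_bracket M A X Y p h"
      using smooth_near_cong[OF V(1,2) bspec[OF V(3)]] *[OF X Y] *[OF Y X]
      by (simp only: lie_bracket_def)
  qed (simp add: lie_bracket_def)
  moreover have "smooth_fun A V (\<lambda>p. lie_bracket M A X Y p f)"
    if V: "openin M V" "V \<subseteq> W" "smooth_fun A V f" for V f
  proof (rule smooth_fun_cong[OF V(1)])
    show "smooth_fun A V (\<lambda>p. X p (\<lambda>q. Y q f) - Y p (\<lambda>q. X q f))"
      using V X Y by (intro smooth_fun_diff vector_field_smooth[of X W] vector_field_smooth[of Y W])
  qed (use V in \<open>simp add: lie_bracket_apply smooth_nearI\<close>)
  ultimately show ?thesis by (rule vector_fieldsI)
qed

lemma lie_bracket_swap: "lie_bracket M A Y X = vf_scale (\<lambda>_. -1) (lie_bracket M A X Y)"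
  by (auto simp: lie_bracket_def vf_scale_def tv_scale_def fun_eq_iff)

text \<open>Each double bracket expands into four third-order terms; in the cyclic sum the twelve
  terms cancel in pairs.\<close>

lemma jacobi_identity:
  assumes W: "openin M W" "p \<in> W"
    and X: "X \<in> vector_fields M A W" and Y: "Y \<in> vector_fields M A W" and Z: "Z \<in> vector_fields M A W"
  shows "lie_bracket M A X (lie_bracket M A Y Z) p f + lie_bracket M A Y (lie_bracket M A Z X) p f
    + lie_bracket M A Z (lie_bracket M A X Y) p f = 0"
proof (cases "smooth_near M A p f")
  case True
  obtain V where V: "openin M V" "p \<in> V" "V \<subseteq> W" "smooth_fun A V f"
    using smooth_near_common[OF W True True] by metis
  have *: "lie_bracket M A U (lie_bracket M A S T) p f
      = U p (\<lambda>q. S q (\<lambda>r. T r f)) - U p (\<lambda>q. T q (\<lambda>r. S r f))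
        - S p (\<lambda>q. T q (\<lambda>r. U r f)) + T p (\<lambda>q. S q (\<lambda>r. U r f))"
    if U: "U \<in> vector_fields M A W" and S: "S \<in> vector_fields M A W" and T: "T \<in> vector_fields M A W" for U S T
  proof -
    have p: "U p \<in> tangent_space M A p" using U V vector_field_at by blast
    have sm: "smooth_fun A V (\<lambda>q. S' q f)" if "S' \<in> vector_fields M A W" for S'
      using V that vector_field_smooth by blast
    have sm2: "smooth_near M A p (\<lambda>q. S' q (\<lambda>r. T' r f))"
      if "S' \<in> vector_fields M A W" "T' \<in> vector_fields M A W" for S' T'
      using V that sm by (intro smooth_nearI[of V] vector_field_smooth[of S' W]) auto
    \<comment> \<open>The inner bracket unfolds to a commutator only where \<open>f\<close> is
      smooth, hence the restriction to \<open>V\<close>.\<close>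
    have "U p (\<lambda>q. lie_bracket M A S T q f) = U p (\<lambda>q. S q (\<lambda>r. T r f) - T q (\<lambda>r. S r f))"
      using V by (intro tangent_space_local[OF p, of V]) (auto simp: lie_bracket_apply smooth_nearI)
    also have "\<dots> = U p (\<lambda>q. S q (\<lambda>r. T r f)) - U p (\<lambda>q. T q (\<lambda>r. S r f))"
      using S T by (intro tangent_space_diff[OF p] sm2)
    finally show ?thesis
      using V sm[OF U] True by (simp add: lie_bracket_apply smooth_nearI)
  qed
  show ?thesis
    using X Y Z by (simp add: *)
qed (simp add: lie_bracket_def)

end

section \<open>Symmetries of the curvature tensor\<close>

context levi_civita
begin

lemma metric_zero: "p \<in> topspace M \<Longrightarrow> v \<in> tangent_space M A p \<Longrightarrow> g p (\<lambda>_. 0) v = 0"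
  using metric_scale[of p v v 0] by (simp add: tv_scale_def)

lemma metric_vf_diff:
  assumes "openin M W" "p \<in> W" "X \<in> vector_fields M A W" "Y \<in> vector_fields M A W"
    and v: "v \<in> tangent_space M A p"
  shows "g p (vf_diff X Y p) v = g p (X p) v - g p (Y p) v"
proof -
  have p: "p \<in> topspace M" using assms(1,2) openin_subset by blast
  have XY: "X p \<in> tangent_space M A p" "Y p \<in> tangent_space M A p"
    using assms vector_field_at by blast+
  show ?thesis
    using metric_add[OF p XY(1) tv_scale_tangent[OF XY(2), of "-1"] v] metric_scale[OF p XY(2) v, of "-1"]
    by (simp add: vf_diff_def vf_add_def vf_scale_def)
qed

context
  fixes W p
  assumes W: "openin M W" and p: "p \<in> W"
begin

lemma p_topspace: "p \<in> topspace M"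
  using W p openin_subset by blast

lemma metric_curvature:
  assumes X: "X \<in> vector_fields M A W" and Y: "Y \<in> vector_fields M A W" and Z: "Z \<in> vector_fields M A W"
    and v: "v \<in> tangent_space M A p"
  shows "g p (curvature M A D X Y Z p) v
    = g p (D X (D Y Z) p) v - g p (D Y (D X Z) p) v - g p (D (lie_bracket M A X Y) Z p) v"
proof -
  have "D X (D Y Z) \<in> vector_fields M A W" "D Y (D X Z) \<in> vector_fields M A W"
    "D (lie_bracket M A X Y) Z \<in> vector_fields M A W"
    using X Y Z W by (auto intro!: conn_field lie_bracket_field)
  then show ?thesis
    unfolding curvature_def using W p v by (simp add: metric_vf_diff vf_diff_field)
qed

lemma metric_curvature_swap:
  assumes X: "X \<in> vector_fields M A W" and Y: "Y \<in> vector_fields M A W" and Z: "Z \<in> vector_fields M A W"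
    and v: "v \<in> tangent_space M A p"
  shows "g p (curvature M A D Y X Z p) v = - g p (curvature M A D X Y Z p) v"
proof -
  have L: "lie_bracket M A X Y \<in> vector_fields M A W"
    using lie_bracket_field[OF W X Y] .
  have "D (lie_bracket M A Y X) Z p = tv_scale (-1) (D (lie_bracket M A X Y) Z p)"
    using conn_scale_left[OF W smooth_fun_const L Z p, of "-1"]
    by (simp add: lie_bracket_swap[of Y X] vf_scale_def)
  moreover have "D (lie_bracket M A X Y) Z p \<in> tangent_space M A p"
    using conn_field[OF W L Z] p vector_field_at by blast
  ultimately show ?thesis
    using metric_curvature[OF X Y Z v] metric_curvature[OF Y X Z v]
    by (simp add: metric_scale[OF p_topspace _ v])
qed

text \<open>Applying X Y - Y X - [X, Y] to the function g(Z, U) gives 0. Metric compatibility turns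
  this into the sum of the two curvature terms, because the mixed terms in \<open>second\<close> are
  together symmetric in the two directions.\<close>

lemma metric_curvature_skew:
  assumes X: "X \<in> vector_fields M A W" and Y: "Y \<in> vector_fields M A W"
    and Z: "Z \<in> vector_fields M A W" and U: "U \<in> vector_fields M A W"
  shows "g p (curvature M A D X Y Z p) (U p) = - g p (curvature M A D X Y U p) (Z p)"
proof -
  have sym: "g p (S p) (T p) = g p (T p) (S p)" if "S \<in> vector_fields M A W" "T \<in> vector_fields M A W" for S T
    using that p vector_field_at by (intro metric_sym[OF p_topspace]) auto
  have second: "S p (\<lambda>q. T q (\<lambda>r. g r (Z r) (U r)))
      = g p (D S (D T Z) p) (U p) + g p (D T Z p) (D S U p)
        + g p (D S Z p) (D T U p) + g p (D S (D T U) p) (Z p)"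
    if S: "S \<in> vector_fields M A W" and T: "T \<in> vector_fields M A W" for S T
  proof -
    have F: "D S Z \<in> vector_fields M A W" "D S U \<in> vector_fields M A W" "D T Z \<in> vector_fields M A W"
        "D T U \<in> vector_fields M A W" "D S (D T U) \<in> vector_fields M A W"
      using S T Z U W by (auto intro!: conn_field)
    have Sp: "S p \<in> tangent_space M A p" using S p vector_field_at by blast
    have "S p (\<lambda>q. T q (\<lambda>r. g r (Z r) (U r))) = S p (\<lambda>q. g q (D T Z q) (U q) + g q (Z q) (D T U q))"
      using metric_compatible[OF W T Z U] W p by (intro tangent_space_local[OF Sp]) auto
    also have "\<dots> = S p (\<lambda>q. g q (D T Z q) (U q)) + S p (\<lambda>q. g q (Z q) (D T U q))"
      using F Z U W p by (intro tangent_space_add[OF Sp] smooth_nearI[of W] metric_smooth) auto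
    finally show ?thesis
      using metric_compatible[OF W S F(3) U p] metric_compatible[OF W S Z F(4) p] sym[OF Z F(5)] by simp
  qed
  have L: "lie_bracket M A X Y \<in> vector_fields M A W"
    using lie_bracket_field[OF W X Y] .
  have "lie_bracket M A X Y p (\<lambda>r. g r (Z r) (U r))
      = g p (D (lie_bracket M A X Y) Z p) (U p) + g p (D (lie_bracket M A X Y) U p) (Z p)"
    using metric_compatible[OF W L Z U p] sym[OF Z conn_field[OF W L U]] by simp
  moreover have "lie_bracket M A X Y p (\<lambda>r. g r (Z r) (U r))
      = X p (\<lambda>q. Y q (\<lambda>r. g r (Z r) (U r))) - Y p (\<lambda>q. X q (\<lambda>r. g r (Z r) (U r)))"
    using metric_smooth[OF W Z U] W p by (intro lie_bracket_apply smooth_nearI)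
  ultimately show ?thesis
    using second[OF X Y] second[OF Y X] metric_curvature[OF X Y Z vector_field_at[OF U p]]
      metric_curvature[OF X Y U vector_field_at[OF Z p]] by simp
qed

text \<open>Regrouped by the outer derivative, the cyclic sum consists of three expressions D S (D T
  U - D U T) - D [T, U] S. Torsion-freeness, used twice, makes each of them [S, [T, U]], and the
  Jacobi identity applies.\<close>

lemma first_bianchi:
  assumes X: "X \<in> vector_fields M A W" and Y: "Y \<in> vector_fields M A W" and Z: "Z \<in> vector_fields M A W"
    and v: "v \<in> tangent_space M A p"
  shows "g p (curvature M A D X Y Z p) v + g p (curvature M A D Y Z X p) v
    + g p (curvature M A D Z X Y p) v = 0"
proof -
  let ?L = "lie_bracket M A"
  have torsion: "g p (D S T p) v - g p (D T S p) v = g p (?L S T p) v"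
    if "S \<in> vector_fields M A W" "T \<in> vector_fields M A W" for S T
    using metric_vf_diff[OF W p conn_field[OF W that] conn_field[OF W that(2,1)] v]
      torsion_free[OF W that p] by simp
  have *: "g p (D S (D T U) p) v - g p (D S (D U T) p) v - g p (D (?L T U) S p) v = g p (?L S (?L T U) p) v"
    if S: "S \<in> vector_fields M A W" and T: "T \<in> vector_fields M A W" and U: "U \<in> vector_fields M A W" for S T U
  proof -
    have F: "D T U \<in> vector_fields M A W" "D U T \<in> vector_fields M A W" "?L T U \<in> vector_fields M A W"
      using S T U W by (auto intro!: conn_field lie_bracket_field)
    have d: "vf_scale (\<lambda>_. -1) (D U T) \<in> vector_fields M A W"
      by (intro vf_scale_field smooth_fun_const F)
    have Sp: "S p \<in> tangent_space M A p" using S p vector_field_at by blast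
    \<comment> \<open>\<open>vf_diff\<close> subtracts by adding the multiple with the constant
      function -1, so the Leibniz rule leaves a term with its derivative. A derivation kills
      constants because 1 * 1 = 1.\<close>
    have "S p (\<lambda>_. -1) = 0"
    proof -
      have "S p (\<lambda>_. 1) = 0"
        using tangent_space_mult[OF Sp smooth_nearI[OF smooth_fun_const W p, of 1]
            smooth_nearI[OF smooth_fun_const W p, of 1]] by simp
      then show ?thesis
        using tangent_space_scale[OF Sp smooth_nearI[OF smooth_fun_const W p, of 1], of "-1"] by simp
    qed
    then have "D S (vf_scale (\<lambda>_. -1) (D U T)) p = vf_scale (\<lambda>_. -1) (D S (D U T)) p"
      using conn_leibniz[OF W smooth_fun_const S F(2) p, of "-1"]
      by (simp add: vf_add_def vf_scale_def tv_add_def tv_scale_def)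
    then have "D S (vf_diff (D T U) (D U T)) p = vf_diff (D S (D T U)) (D S (D U T)) p"
      using conn_add_right[OF W S F(1) d p] by (simp add: vf_diff_def vf_add_def)
    \<comment> \<open>Torsion-freeness equates values at the points of \<open>W\<close>; locality of
      the connection carries this over to the derivative.\<close>
    moreover have "D S (?L T U) p = D S (vf_diff (D T U) (D U T)) p"
      using torsion_free[OF W T U]
      by (intro conn_local[OF W S S F(3) vf_diff_field[OF F(1,2)] _ _ p]) auto
    ultimately have "g p (D S (?L T U) p) v = g p (D S (D T U) p) v - g p (D S (D U T) p) v"
      using metric_vf_diff[OF W p conn_field[OF W S F(1)] conn_field[OF W S F(2)] v] by simp
    then show ?thesis using torsion[OF S F(3)] by simp
  qed
  let ?a = "?L X (?L Y Z) p" and ?b = "?L Y (?L Z X) p" and ?c = "?L Z (?L X Y) p"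
  have T: "?a \<in> tangent_space M A p" "?b \<in> tangent_space M A p" "?c \<in> tangent_space M A p"
    using X Y Z W p by (auto intro!: vector_field_at[of _ W] lie_bracket_field)
  have "g p ?a v + g p ?b v + g p ?c v = g p (tv_add (tv_add ?a ?b) ?c) v"
    using T v p_topspace by (simp add: metric_add tv_add_tangent)
  also have "tv_add (tv_add ?a ?b) ?c = (\<lambda>_. 0)"
    using jacobi_identity[OF W p X Y Z] by (simp add: tv_add_def)
  finally have "g p ?a v + g p ?b v + g p ?c v = 0"
    using metric_zero[OF p_topspace v] by simp
  then show ?thesis
    using *[OF X Y Z] *[OF Y Z X] *[OF Z X Y] metric_curvature[OF X Y Z v] metric_curvature[OF Y Z X v]
      metric_curvature[OF Z X Y v] by simp
qed

end

end

section \<open>Exterior products of two-forms\<close>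

text \<open>For skew forms this is the exterior product written over shuffles: six ways to give two
  of four slots to \<open>P\<close>. \<open>wedge222\<close> and \<open>wedge1222\<close> extend it
  by choosing the two slots of a third two-form (15 ways) and the slot of a covector (7
  ways).\<close>

definition wedge22 :: "('n \<Rightarrow> 'n \<Rightarrow> real) \<Rightarrow> ('n \<Rightarrow> 'n \<Rightarrow> real) \<Rightarrow> 'n \<Rightarrow> 'n \<Rightarrow> 'n \<Rightarrow> 'n \<Rightarrow> real" where
  "wedge22 P Q a b c d =
     P a b * Q c d - P a c * Q b d + P a d * Q b c + P b c * Q a d - P b d * Q a c + P c d * Q a b"

definition wedge222 ::
    "('n \<Rightarrow> 'n \<Rightarrow> real) \<Rightarrow> ('n \<Rightarrow> 'n \<Rightarrow> real) \<Rightarrow> ('n \<Rightarrow> 'n \<Rightarrow> real) \<Rightarrow>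
     'n \<Rightarrow> 'n \<Rightarrow> 'n \<Rightarrow> 'n \<Rightarrow> 'n \<Rightarrow> 'n \<Rightarrow> real" where
  "wedge222 P Q R a b c d e f =
     wedge22 P Q c d e f * R a b
     - wedge22 P Q b d e f * R a c
     + wedge22 P Q b c e f * R a d
     - wedge22 P Q b c d f * R a e
     + wedge22 P Q b c d e * R a f
     + wedge22 P Q a d e f * R b c
     - wedge22 P Q a c e f * R b d
     + wedge22 P Q a c d f * R b e
     - wedge22 P Q a c d e * R b f
     + wedge22 P Q a b e f * R c d
     - wedge22 P Q a b d f * R c e
     + wedge22 P Q a b d e * R c f
     + wedge22 P Q a b c f * R d e
     - wedge22 P Q a b c e * R d f
     + wedge22 P Q a b c d * R e f"

definition wedge1222 ::
    "('n \<Rightarrow> real) \<Rightarrow> ('n \<Rightarrow> 'n \<Rightarrow> real) \<Rightarrow> ('n \<Rightarrow> 'n \<Rightarrow> real) \<Rightarrow> ('n \<Rightarrow> 'n \<Rightarrow> real) \<Rightarrow>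
     'n \<Rightarrow> 'n \<Rightarrow> 'n \<Rightarrow> 'n \<Rightarrow> 'n \<Rightarrow> 'n \<Rightarrow> 'n \<Rightarrow> real" where
  "wedge1222 l P Q R a b c d e f h =
     l a * wedge222 P Q R b c d e f h
     - l b * wedge222 P Q R a c d e f h
     + l c * wedge222 P Q R a b d e f h
     - l d * wedge222 P Q R a b c e f h
     + l e * wedge222 P Q R a b c d f h
     - l f * wedge222 P Q R a b c d e h
     + l h * wedge222 P Q R a b c d e f"

lemma wedge22_swap:
  fixes P Q :: "'n \<Rightarrow> 'n \<Rightarrow> real"
  assumes "\<And>x y. P y x = - P x y" "\<And>x y. Q y x = - Q x y"
  shows
    "wedge22 P Q b a c d = - wedge22 P Q a b c d"
    "wedge22 P Q a c b d = - wedge22 P Q a b c d"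
    "wedge22 P Q a b d c = - wedge22 P Q a b c d"
  using assms(1)[of a b] assms(2)[of a b] assms(1)[of b c] assms(2)[of b c] assms(1)[of c d] assms(2)[of c d]
  by (simp_all add: wedge22_def)

lemma wedge222_swap:
  fixes P Q R :: "'n \<Rightarrow> 'n \<Rightarrow> real"
  assumes "\<And>x y. P y x = - P x y" "\<And>x y. Q y x = - Q x y" "\<And>x y. R y x = - R x y"
  shows
    "wedge222 P Q R b a c d e f = - wedge222 P Q R a b c d e f"
    "wedge222 P Q R a c b d e f = - wedge222 P Q R a b c d e f"
    "wedge222 P Q R a b d c e f = - wedge222 P Q R a b c d e f"
    "wedge222 P Q R a b c e d f = - wedge222 P Q R a b c d e f"
    "wedge222 P Q R a b c d f e = - wedge222 P Q R a b c d e f"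
proof -
  note s = wedge22_swap[of P Q, OF assms(1,2)]
  show "wedge222 P Q R b a c d e f = - wedge222 P Q R a b c d e f"
    by (simp add: wedge222_def s(1)[of a b] s(2)[of _ a b] s(3)[of _ _ a b] assms(3)[of a b])
  show "wedge222 P Q R a c b d e f = - wedge222 P Q R a b c d e f"
    by (simp add: wedge222_def s(1)[of b c] s(2)[of _ b c] s(3)[of _ _ b c] assms(3)[of b c])
  show "wedge222 P Q R a b d c e f = - wedge222 P Q R a b c d e f"
    by (simp add: wedge222_def s(1)[of c d] s(2)[of _ c d] s(3)[of _ _ c d] assms(3)[of c d])
  show "wedge222 P Q R a b c e d f = - wedge222 P Q R a b c d e f"
    by (simp add: wedge222_def s(1)[of d e] s(2)[of _ d e] s(3)[of _ _ d e] assms(3)[of d e])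
  show "wedge222 P Q R a b c d f e = - wedge222 P Q R a b c d e f"
    by (simp add: wedge222_def s(1)[of e f] s(2)[of _ e f] s(3)[of _ _ e f] assms(3)[of e f])
qed

lemma wedge1222_swap:
  fixes P Q R :: "'n \<Rightarrow> 'n \<Rightarrow> real"
  assumes "\<And>x y. P y x = - P x y" "\<And>x y. Q y x = - Q x y" "\<And>x y. R y x = - R x y"
  shows
    "wedge1222 l P Q R b a c d e f h = - wedge1222 l P Q R a b c d e f h"
    "wedge1222 l P Q R a c b d e f h = - wedge1222 l P Q R a b c d e f h"
    "wedge1222 l P Q R a b d c e f h = - wedge1222 l P Q R a b c d e f h"
    "wedge1222 l P Q R a b c e d f h = - wedge1222 l P Q R a b c d e f h"
    "wedge1222 l P Q R a b c d f e h = - wedge1222 l P Q R a b c d e f h"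
    "wedge1222 l P Q R a b c d e h f = - wedge1222 l P Q R a b c d e f h"
proof -
  note s = wedge222_swap[of P Q R, OF assms]
  show "wedge1222 l P Q R b a c d e f h = - wedge1222 l P Q R a b c d e f h"
    by (simp add: wedge1222_def s(1)[of a b] s(2)[of _ a b] s(3)[of _ _ a b]
        s(4)[of _ _ _ a b] s(5)[of _ _ _ _ a b])
  show "wedge1222 l P Q R a c b d e f h = - wedge1222 l P Q R a b c d e f h"
    by (simp add: wedge1222_def s(1)[of b c] s(2)[of _ b c] s(3)[of _ _ b c]
        s(4)[of _ _ _ b c] s(5)[of _ _ _ _ b c])
  show "wedge1222 l P Q R a b d c e f h = - wedge1222 l P Q R a b c d e f h"
    by (simp add: wedge1222_def s(1)[of c d] s(2)[of _ c d] s(3)[of _ _ c d]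
        s(4)[of _ _ _ c d] s(5)[of _ _ _ _ c d])
  show "wedge1222 l P Q R a b c e d f h = - wedge1222 l P Q R a b c d e f h"
    by (simp add: wedge1222_def s(1)[of d e] s(2)[of _ d e] s(3)[of _ _ d e]
        s(4)[of _ _ _ d e] s(5)[of _ _ _ _ d e])
  show "wedge1222 l P Q R a b c d f e h = - wedge1222 l P Q R a b c d e f h"
    by (simp add: wedge1222_def s(1)[of e f] s(2)[of _ e f] s(3)[of _ _ e f]
        s(4)[of _ _ _ e f] s(5)[of _ _ _ _ e f])
  show "wedge1222 l P Q R a b c d e h f = - wedge1222 l P Q R a b c d e f h"
    by (simp add: wedge1222_def s(1)[of f h] s(2)[of _ f h] s(3)[of _ _ f h]
        s(4)[of _ _ _ f h] s(5)[of _ _ _ _ f h])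
qed

text \<open>Forms of even degree commute.\<close>

lemma wedge222_commute:
  "wedge222 Q P R a b c d e f = wedge222 P Q R a b c d e f"
  "wedge222 R Q P a b c d e f = wedge222 P Q R a b c d e f"
  by (simp_all add: wedge222_def wedge22_def algebra_simps)

text \<open>Adjacent exchanges bring two equal entries together, each at the cost of a sign.
  Exchanging the two equal neighbours then leaves the list unchanged but flips the sign, so the
  value is 0.\<close>

lemma alternating_repeat:
  fixes F :: "'a list \<Rightarrow> real"
  assumes swap: "\<And>us a b vs. length us + length vs + 2 = n \<Longrightarrow> F (us @ b # a # vs) = - F (us @ a # b # vs)"
    and "length xs = n" "\<not> distinct xs"
  shows "F xs = 0"
proof -
  have *: "F (us @ [a] @ vs @ [a] @ ws) = 0" if "length us + length vs + length ws + 2 = n" for us vs ws a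
    using that
  proof (induction vs arbitrary: us)
    case Nil
    then show ?case using swap[of us ws a a] by simp
  next
    case (Cons v vs)
    have "F ((us @ [v]) @ [a] @ vs @ [a] @ ws) = 0"
      using Cons.prems by (intro Cons.IH) simp
    then show ?case
      using swap[of us "vs @ [a] @ ws" a v] Cons.prems by simp
  qed
  obtain us vs ws a where "xs = us @ [a] @ vs @ [a] @ ws"
    using not_distinct_decomp[OF assms(3)] by blast
  with * assms(2) show ?thesis by simp
qed

lemma wedge1222_zero:
  fixes P Q R :: "'n::finite \<Rightarrow> 'n \<Rightarrow> real"
  assumes "\<And>x y. P y x = - P x y" "\<And>x y. Q y x = - Q x y" "\<And>x y. R y x = - R x y"
    and "CARD('n) = 6"
  shows "wedge1222 l P Q R a b c d e f h = 0"
proof -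
  \<comment> \<open>As a function of a list, the six transposition rules become one rule for
    neighbouring entries.\<close>
  define F where "F xs = wedge1222 l P Q R (xs ! 0) (xs ! 1) (xs ! 2) (xs ! 3) (xs ! 4) (xs ! 5) (xs ! 6)"
    for xs
  note swap = wedge1222_swap[of P Q R l, OF assms(1-3)]
  have "F [a, b, c, d, e, f, h] = 0"
  proof (rule alternating_repeat)
    fix us vs :: "'n list" and a b
    assume len: "length us + length vs + 2 = 7"
    then consider "length us = 0" | "length us = 1" | "length us = 2" | "length us = 3"
      | "length us = 4" | "length us = 5" by linarith
    then show "F (us @ b # a # vs) = - F (us @ a # b # vs)"
    proof cases
    qed (simp_all add: F_def nth_append, (rule swap)+)
  next
    show "\<not> distinct [a, b, c, d, e, f, h]"
    proof
      assume "distinct [a, b, c, d, e, f, h]"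
      then have "card (set [a, b, c, d, e, f, h]) = 7"
        by (simp only: distinct_card) simp
      moreover have "card (set [a, b, c, d, e, f, h]) \<le> CARD('n)"
        by (intro card_mono) auto
      ultimately show False using assms(4) by simp
    qed
  qed simp
  then show ?thesis by (simp add: F_def)
qed

lemma sum_swap_blocks:
  "(\<Sum>a\<in>UNIV. \<Sum>b\<in>UNIV. \<Sum>c\<in>UNIV. \<Sum>d\<in>UNIV. F a b c d)
    = (\<Sum>a\<in>UNIV. \<Sum>b\<in>UNIV. \<Sum>c\<in>UNIV. \<Sum>d\<in>UNIV. F c d a b)"
  for F :: "'n::finite \<Rightarrow> 'n \<Rightarrow> 'n \<Rightarrow> 'n \<Rightarrow> real"
proof -
  have "(\<Sum>a\<in>UNIV. \<Sum>b\<in>UNIV. \<Sum>c\<in>UNIV. \<Sum>d\<in>UNIV. F a b c d)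
      = (\<Sum>x\<in>UNIV. \<Sum>y\<in>UNIV. F (fst x) (snd x) (fst y) (snd y))"
    by (simp add: sum.cartesian_product' flip: UNIV_Times_UNIV)
  also have "\<dots> = (\<Sum>y\<in>UNIV. \<Sum>x\<in>UNIV. F (fst x) (snd x) (fst y) (snd y))"
    by (rule sum.swap)
  also have "\<dots> = (\<Sum>a\<in>UNIV. \<Sum>b\<in>UNIV. \<Sum>c\<in>UNIV. \<Sum>d\<in>UNIV. F c d a b)"
    by (simp add: sum.cartesian_product' flip: UNIV_Times_UNIV)
  finally show ?thesis .
qed

text \<open>The exchange of the outer blocks is composed of three exchanges of neighbouring
  blocks.\<close>

lemma sum_swap_outer_blocks:
  "(\<Sum>a\<in>UNIV. \<Sum>b\<in>UNIV. \<Sum>c\<in>UNIV. \<Sum>d\<in>UNIV. \<Sum>e\<in>UNIV. \<Sum>f\<in>UNIV. F a b c d e f)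
    = (\<Sum>a\<in>UNIV. \<Sum>b\<in>UNIV. \<Sum>c\<in>UNIV. \<Sum>d\<in>UNIV. \<Sum>e\<in>UNIV. \<Sum>f\<in>UNIV. F e f c d a b)"
  for F :: "'n::finite \<Rightarrow> 'n \<Rightarrow> 'n \<Rightarrow> 'n \<Rightarrow> 'n \<Rightarrow> 'n \<Rightarrow> real"
  apply (subst sum_swap_blocks)
  apply (subst (3) sum_swap_blocks)
  apply (subst sum_swap_blocks)
  apply (rule refl)
  done

lemma wedge222_minus: "wedge222 (\<lambda>x y. - P x y) Q R a b c d e f = - wedge222 P Q R a b c d e f"
  by (simp add: wedge222_def wedge22_def algebra_simps)

text \<open>Moving a pair of slots across a neighbouring pair takes four transpositions, so no sign
  remains; the outer exchange is three such moves.\<close>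

lemma wedge222_argument_blocks:
  fixes P Q R :: "'n \<Rightarrow> 'n \<Rightarrow> real"
  assumes "\<And>x y. P y x = - P x y" "\<And>x y. Q y x = - Q x y" "\<And>x y. R y x = - R x y"
  shows "wedge222 P Q R c d a b e f = wedge222 P Q R a b c d e f"
    and "wedge222 P Q R e f c d a b = wedge222 P Q R a b c d e f"
proof -
  note swap = wedge222_swap[of P Q R, OF assms]
  have *: "wedge222 P Q R c d a b e f = wedge222 P Q R a b c d e f" for a b c d e f
    using swap(2)[of c d a b e f] swap(1)[of c a d b e f] swap(3)[of a c d b e f] swap(2)[of a c b d e f]
    by simp
  moreover have "wedge222 P Q R a b e f c d = wedge222 P Q R a b c d e f" for a b c d e f
    using swap(4)[of a b e f c d] swap(3)[of a b e c f d] swap(5)[of a b c e f d] swap(4)[of a b c e d f]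
    by simp
  ultimately show "wedge222 P Q R e f c d a b = wedge222 P Q R a b c d e f" by metis
  show "wedge222 P Q R c d a b e f = wedge222 P Q R a b c d e f" by (rule *)
qed

section \<open>Algebraic curvature tensors and their contracted cube\<close>

locale algebraic_curvature =
  fixes W :: "'n::finite tensor4"
  assumes skew_left: "W b a c d = - W a b c d"
    and skew_right: "W a b d c = - W a b c d"
    and bianchi: "W a b c d + W b c a d + W c a b d = 0"
begin

text \<open>The Bianchi sums starting at \<open>a\<close>, \<open>b\<close>, \<open>c\<close>,
  \<open>d\<close>, taken with the signs + + - -, reduce by skew-symmetry to twice the difference of
  the two sides.\<close>

lemma pair_sym: "W c d a b = W a b c d"
  using bianchi[of a b c d] bianchi[of b c d a] bianchi[of c d a b] bianchi[of d a b c]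
    skew_left[of a b] skew_left[of b c] skew_left[of c d] skew_left[of d a] skew_left[of a c] skew_left[of b d]
    skew_right[of _ _ a b] skew_right[of _ _ b c] skew_right[of _ _ c d] skew_right[of _ _ d a]
    skew_right[of _ _ a c] skew_right[of _ _ b d]
  by (smt (verit))

text \<open>The first six arguments name the three two-forms; the remaining six are the slots of
  their exterior product.\<close>

definition cubic :: "'n \<Rightarrow> 'n \<Rightarrow> 'n \<Rightarrow> 'n \<Rightarrow> 'n \<Rightarrow> 'n \<Rightarrow> 'n \<Rightarrow> 'n \<Rightarrow> 'n \<Rightarrow> 'n \<Rightarrow> 'n \<Rightarrow> 'n \<Rightarrow> real" where
  "cubic a b c d e f = wedge222 (W a b) (W c d) (W e f)"

text \<open>Up to a factor, the contraction of the cube of \<open>W\<close>, antisymmetrised over six upper indices,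
  in all but one pair of indices.\<close>

definition cubic_trace :: "'n \<Rightarrow> 'n \<Rightarrow> real" where
  "cubic_trace i j =
     (\<Sum>b\<in>UNIV. \<Sum>c\<in>UNIV. \<Sum>d\<in>UNIV. \<Sum>e\<in>UNIV. \<Sum>f\<in>UNIV. cubic j b c d e f i b c d e f)"

lemmas cubic_swap = wedge222_swap[of "W a b" "W c d" "W e f" for a b c d e f, OF skew_right skew_right skew_right,
    folded cubic_def]

lemmas cubic_argument_blocks =
  wedge222_argument_blocks[of "W a b" "W c d" "W e f" for a b c d e f, OF skew_right skew_right skew_right,
    folded cubic_def]

lemma cubic_blocks:
  "cubic c d a b e f = cubic a b c d e f" "cubic e f c d a b = cubic a b c d e f"
  using wedge222_commute(1)[of "W c d" "W a b" "W e f"] wedge222_commute(2)[of "W e f" "W c d" "W a b"]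
  by (simp_all add: cubic_def fun_eq_iff)

lemma cubic_skew: "cubic b a c d e f p q r s t u = - cubic a b c d e f p q r s t u"
proof -
  have "W b a = (\<lambda>x y. - W a b x y)"
    using skew_left[of a b] by (simp add: fun_eq_iff)
  then show ?thesis by (simp add: cubic_def wedge222_minus)
qed

lemma cubic_trace_identity:
  assumes "CARD('n) = 6"
  shows "6 * cubic_trace i j = (if i = j then \<Sum>k\<in>UNIV. cubic_trace k k else 0)"
proof -
  \<comment> \<open>Contract the vanishing antisymmetrisation over \<open>a, \<dots>, f, i\<close>: the terms in which \<open>l\<close> takes
    one of the summation indices all agree, by the symmetries of \<open>cubic\<close>.\<close>
  define l :: "'n \<Rightarrow> real" where "l x = (if x = j then 1 else 0)" for x
  define S where "S F = (\<Sum>a\<in>UNIV. \<Sum>b\<in>UNIV. \<Sum>c\<in>UNIV. \<Sum>d\<in>UNIV. \<Sum>e\<in>UNIV. \<Sum>f\<in>UNIV. F a b c d e f)"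
    for F :: "'n \<Rightarrow> 'n \<Rightarrow> 'n \<Rightarrow> 'n \<Rightarrow> 'n \<Rightarrow> 'n \<Rightarrow> real"
  define X where "X = S (\<lambda>a b c d e f. l a * cubic a b c d e f i b c d e f)"
  have S_add: "S (\<lambda>a b c d e f. F a b c d e f + G a b c d e f) = S F + S G" for F G
    by (simp add: S_def sum.distrib)
  have S12: "S (\<lambda>a b c d e f. F a b c d e f) = S (\<lambda>a b c d e f. F b a c d e f)" for F
    unfolding S_def by (rule sum.swap)
  have S_block: "S (\<lambda>a b c d e f. F a b c d e f) = S (\<lambda>a b c d e f. F c d a b e f)"
      "S (\<lambda>a b c d e f. F a b c d e f) = S (\<lambda>a b c d e f. F e f c d a b)" for F
    unfolding S_def by (rule sum_swap_blocks sum_swap_outer_blocks)+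
  \<comment> \<open>Exchanging \<open>a\<close> and \<open>b\<close> changes the sign twice: in the
    two-form \<open>W a b\<close> and in the slots.\<close>
  have x2: "S (\<lambda>a b c d e f. l b * cubic a b c d e f a i c d e f) = X"
  proof -
    have "l a * cubic b a c d e f b i c d e f = l a * cubic a b c d e f i b c d e f" for a b c d e f
      using cubic_skew[of b a c d e f b i c d e f] cubic_swap(1)[of a b c d e f b i c d e f] by simp
    then show ?thesis unfolding X_def by (subst S12) (simp only:)
  qed
  \<comment> \<open>Block exchanges keep first and second slots apart: \<open>x3\<close> and
    \<open>x5\<close> reduce to \<open>X\<close>, but \<open>x4\<close> and \<open>x6\<close> to
    \<open>x2\<close>.\<close>
  have x3: "S (\<lambda>a b c d e f. l c * cubic a b c d e f a b i d e f) = X"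
  proof -
    have "l a * cubic c d a b e f c d i b e f = l a * cubic a b c d e f i b c d e f" for a b c d e f
      using cubic_blocks(1)[of c d a b e f] cubic_argument_blocks(1)[of a b c d e f c d i b e f] by simp
    then show ?thesis unfolding X_def by (subst S_block(1)) (simp only:)
  qed
  have x4: "S (\<lambda>a b c d e f. l d * cubic a b c d e f a b c i e f) = X"
  proof -
    have "l b * cubic c d a b e f c d a i e f = l b * cubic a b c d e f a i c d e f" for a b c d e f
      using cubic_blocks(1)[of c d a b e f] cubic_argument_blocks(1)[of a b c d e f c d a i e f] by simp
    then show ?thesis unfolding x2[symmetric] by (subst S_block(1)) (simp only:)
  qed
  have x5: "S (\<lambda>a b c d e f. l e * cubic a b c d e f a b c d i f) = X"
  proof -
    have "l a * cubic e f c d a b e f c d i b = l a * cubic a b c d e f i b c d e f" for a b c d e f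
      using cubic_blocks(2)[of e f c d a b] cubic_argument_blocks(2)[of a b c d e f e f c d i b] by simp
    then show ?thesis unfolding X_def by (subst S_block(2)) (simp only:)
  qed
  have x6: "S (\<lambda>a b c d e f. l f * cubic a b c d e f a b c d e i) = X"
  proof -
    have "l b * cubic e f c d a b e f c d a i = l b * cubic a b c d e f a i c d e f" for a b c d e f
      using cubic_blocks(2)[of e f c d a b] cubic_argument_blocks(2)[of a b c d e f e f c d a i] by simp
    then show ?thesis unfolding x2[symmetric] by (subst S_block(2)) (simp only:)
  qed
  have "l i * cubic a b c d e f a b c d e f
      = l a * cubic a b c d e f i b c d e f + l b * cubic a b c d e f a i c d e f
        + l c * cubic a b c d e f a b i d e f + l d * cubic a b c d e f a b c i e f
        + l e * cubic a b c d e f a b c d i f + l f * cubic a b c d e f a b c d e i" for a b c d e f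
  proof -
    note sw = cubic_swap[of a b c d e f]
    \<comment> \<open>Moving \<open>i\<close> from the end into the gap left by the argument of
      \<open>l\<close> takes 5, 4, 3, 2, 1 or 0 transpositions. Combined with the alternating signs
      of \<open>wedge1222\<close>, all six terms get the same sign.\<close>
    have "cubic a b c d e f b c d e f i = - cubic a b c d e f i b c d e f"
      using sw(5)[of b c d e f i] sw(4)[of b c d e i f] sw(3)[of b c d i e f] sw(2)[of b c i d e f]
        sw(1)[of b i c d e f] by simp
    moreover have "cubic a b c d e f a c d e f i = cubic a b c d e f a i c d e f"
      using sw(5)[of a c d e f i] sw(4)[of a c d e i f] sw(3)[of a c d i e f] sw(2)[of a c i d e f] by simp
    moreover have "cubic a b c d e f a b d e f i = - cubic a b c d e f a b i d e f"
      using sw(5)[of a b d e f i] sw(4)[of a b d e i f] sw(3)[of a b d i e f] by simp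
    moreover have "cubic a b c d e f a b c e f i = cubic a b c d e f a b c i e f"
      using sw(5)[of a b c e f i] sw(4)[of a b c e i f] by simp
    moreover have "cubic a b c d e f a b c d f i = - cubic a b c d e f a b c d i f"
      using sw(5)[of a b c d f i] by simp
    moreover have "wedge1222 l (W a b) (W c d) (W e f) a b c d e f i = 0"
      by (rule wedge1222_zero[OF skew_right skew_right skew_right assms])
    ultimately show ?thesis
      by (simp add: wedge1222_def flip: cubic_def)
  qed
  then have "S (\<lambda>a b c d e f. l i * cubic a b c d e f a b c d e f) = 6 * X"
    by (simp add: S_add X_def[symmetric] x2 x3 x4 x5 x6)
  moreover have "S (\<lambda>a b c d e f. l i * cubic a b c d e f a b c d e f) = l i * (\<Sum>k\<in>UNIV. cubic_trace k k)"
    by (simp add: S_def cubic_trace_def sum_distrib_left)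
  moreover have "X = (\<Sum>a\<in>UNIV. l a * cubic_trace i a)"
    by (simp add: X_def S_def cubic_trace_def sum_distrib_left)
  ultimately show ?thesis by (simp add: l_def if_distrib[of "\<lambda>x. x * _"] cong: if_cong)
qed

end

section \<open>Contractions of trace-free curvature tensors\<close>

lemma sum5_UNIV:
  "(\<Sum>b\<in>UNIV. \<Sum>c\<in>UNIV. \<Sum>d\<in>UNIV. \<Sum>e\<in>UNIV. \<Sum>f\<in>UNIV. F b c d e f)
    = (\<Sum>(b, c, d, e, f)\<in>UNIV. F b c d e f)"
  for F :: "'n::finite \<Rightarrow> 'n \<Rightarrow> 'n \<Rightarrow> 'n \<Rightarrow> 'n \<Rightarrow> real"
  by (simp add: sum.cartesian_product flip: UNIV_Times_UNIV)

context algebraic_curvature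
begin

text \<open>By the Bianchi identity \<open>W a v c u\<close> is \<open>W a u c v\<close> minus
  \<open>W a c u v\<close>. With the skewness of \<open>X\<close>, exchanging \<open>u\<close> and
  \<open>v\<close> turns the left sum L into T - L, where T is the sum with
  \<open>W a c u v\<close>.\<close>

lemma half_bianchi:
  assumes "\<And>x y. X y x = - X x y"
  shows "(\<Sum>u\<in>UNIV. \<Sum>v\<in>UNIV. W a u c v * X u v) = 1/2 * (\<Sum>u\<in>UNIV. \<Sum>v\<in>UNIV. W a c u v * X u v)"
proof -
  have "(\<Sum>u\<in>UNIV. \<Sum>v\<in>UNIV. W a u c v * X u v) = (\<Sum>u\<in>UNIV. \<Sum>v\<in>UNIV. W a v c u * X v u)"
    by (rule sum.swap)
  also have "\<dots> = (\<Sum>u\<in>UNIV. \<Sum>v\<in>UNIV. W a c u v * X u v - W a u c v * X u v)"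
  proof (intro sum.cong refl)
    fix u v
    have "W a v c u = W a u c v - W a c u v"
      using bianchi[of a u c v] skew_left[of a c u v] pair_sym[of u c a v] skew_right[of a v c u] by simp
    moreover have "X v u = - X u v" by (rule assms)
    ultimately show "W a v c u * X v u = W a c u v * X u v - W a u c v * X u v"
      by (simp only:) (simp add: algebra_simps)
  qed
  finally show ?thesis by (simp add: sum_subtractf)
qed

text \<open>The Bianchi identity splits one factor into the one that occurs in \<open>R_ring\<close>
  and a rest. In the rest \<open>half_bianchi\<close> applies twice, to \<open>u\<close>,
  \<open>v\<close> and then to \<open>b\<close>, \<open>d\<close>; this gives 1/4, and one reversed
  index pair gives the sign.\<close>

lemma ring_variant:
  "(\<Sum>b\<in>UNIV. \<Sum>c\<in>UNIV. \<Sum>d\<in>UNIV. \<Sum>e\<in>UNIV. \<Sum>f\<in>UNIV. W j b d e * W c d b f * W e f i c)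
    = R_ring W i j - 1/4 * R_hat W i j"
proof -
  define Y where "Y c b d = 1/2 * (\<Sum>u\<in>UNIV. \<Sum>v\<in>UNIV. W j c u v * W v u b d)" for c b d
  have Y_skew: "Y c y x = - Y c x y" for c x y
    by (simp add: Y_def skew_right[of _ _ y x] sum_negf)
  have hat: "R_hat W i j
      = (\<Sum>b\<in>UNIV. \<Sum>c\<in>UNIV. \<Sum>d\<in>UNIV. \<Sum>u\<in>UNIV. \<Sum>v\<in>UNIV. - (W i b c d * W j b u v * W v u c d))"
    unfolding R_hat_def
  proof (intro sum.cong refl)
    fix b c d u v
    show "W i b c d * W j b u v * W c d u v = - (W i b c d * W j b u v * W v u c d)"
      using skew_left[of v u c d] pair_sym[of c d u v] by simp
  qed
  have "(\<Sum>b\<in>UNIV. \<Sum>c\<in>UNIV. \<Sum>d\<in>UNIV. \<Sum>e\<in>UNIV. \<Sum>f\<in>UNIV. W j b d e * W c d b f * W e f i c)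
      = (\<Sum>b\<in>UNIV. \<Sum>c\<in>UNIV. \<Sum>d\<in>UNIV. \<Sum>u\<in>UNIV. \<Sum>v\<in>UNIV. W i b c d * W j u c v * (W b u d v + W v u b d))"
    unfolding sum5_UNIV
  proof (rule sum.reindex_bij_witness[where i = "\<lambda>(b, c, d, u, v). (u, b, v, c, d)" and j = "\<lambda>(b, c, d, e, f). (c, e, f, b, d)"])
    fix x :: "'n \<times> 'n \<times> 'n \<times> 'n \<times> 'n"
    obtain u b v c d where x: "x = (u, b, v, c, d)" by (metis surj_pair)
    have "- W b v u d = W b u d v + W v u b d"
      using bianchi[of b v u d] skew_left[of u b v d] skew_right[of b u v d] pair_sym[of u b v d]
        pair_sym[of b u d v] skew_left[of b u d v] by (smt (verit) skew_left skew_right pair_sym)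
    moreover have "W j u v c * W b v u d * W c d i b = W i b c d * W j u c v * (- W b v u d)"
      using skew_right[of j u v c] pair_sym[of c d i b] by simp
    ultimately show "(case case x of (b, c, d, e, f) \<Rightarrow> (c, e, f, b, d) of (b, c, d, u, v) \<Rightarrow> W i b c d * W j u c v * (W b u d v + W v u b d))
        = (case x of (b, c, d, e, f) \<Rightarrow> W j b d e * W c d b f * W e f i c)"
      by (simp add: x)
  qed auto
  also have "\<dots> = R_ring W i j + (\<Sum>b\<in>UNIV. \<Sum>c\<in>UNIV. \<Sum>d\<in>UNIV. W i b c d * (\<Sum>u\<in>UNIV. \<Sum>v\<in>UNIV. W j u c v * W v u b d))"
    by (simp add: R_ring_def algebra_simps sum.distrib sum_distrib_left)
  also have "(\<Sum>b\<in>UNIV. \<Sum>c\<in>UNIV. \<Sum>d\<in>UNIV. W i b c d * (\<Sum>u\<in>UNIV. \<Sum>v\<in>UNIV. W j u c v * W v u b d))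
      = (\<Sum>c\<in>UNIV. \<Sum>b\<in>UNIV. \<Sum>d\<in>UNIV. W i b c d * (\<Sum>u\<in>UNIV. \<Sum>v\<in>UNIV. W j u c v * W v u b d))"
    by (rule sum.swap)
  also have "\<dots> = (\<Sum>c\<in>UNIV. \<Sum>b\<in>UNIV. \<Sum>d\<in>UNIV. W i b c d * Y c b d)"
    by (simp only: half_bianchi[of "\<lambda>u v. W v u b d" j c for b c d, OF skew_left] Y_def)
  also have "\<dots> = (\<Sum>c\<in>UNIV. 1/2 * (\<Sum>b\<in>UNIV. \<Sum>d\<in>UNIV. W i c b d * Y c b d))"
    by (simp only: half_bianchi[of "Y c" i c for c, OF Y_skew])
  also have "\<dots> = - 1/4 * R_hat W i j"
    by (simp add: hat Y_def sum_distrib_left sum_negf mult.assoc)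
  finally show ?thesis by simp
qed

end

section \<open>The contracted cube of a trace-free tensor\<close>

locale weyl_tensor = algebraic_curvature W for W :: "'n::finite tensor4" +
  assumes trace: "(\<Sum>a\<in>UNIV. W a i j a) = 0"
begin

lemma traces:
  "(\<Sum>a\<in>UNIV. W a i j a) = 0" "(\<Sum>a\<in>UNIV. W a i a j) = 0"
  "(\<Sum>a\<in>UNIV. W i a a j) = 0" "(\<Sum>a\<in>UNIV. W i a j a) = 0"
  "W a a x y = 0" "W x y a a = 0"
proof -
  show 1: "(\<Sum>a\<in>UNIV. W a i j a) = 0" for i j by (rule trace)
  have "(\<Sum>a\<in>UNIV. W a i a j) = (\<Sum>a\<in>UNIV. - W a i j a)"
    by (intro sum.cong refl skew_right)
  with 1 show "(\<Sum>a\<in>UNIV. W a i a j) = 0" by (simp add: sum_negf)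
  have "(\<Sum>a\<in>UNIV. W i a j a) = (\<Sum>a\<in>UNIV. - W a i j a)"
    by (intro sum.cong refl skew_left)
  with 1 show "(\<Sum>a\<in>UNIV. W i a j a) = 0" by (simp add: sum_negf)
  have "(\<Sum>a\<in>UNIV. W i a a j) = (\<Sum>a\<in>UNIV. W a i j a)"
    by (intro sum.cong refl) (metis skew_left skew_right add.inverse_inverse)
  with 1 show "(\<Sum>a\<in>UNIV. W i a a j) = 0" by simp
  show "W a a x y = 0" "W x y a a = 0"
    using skew_left[of a a x y] skew_right[of x y a a] by simp_all
qed

lemma trace_mult:
  "(\<Sum>a\<in>UNIV. h * W a i j a) = 0" "(\<Sum>a\<in>UNIV. h * W a i a j) = 0"
  "(\<Sum>a\<in>UNIV. h * W i a a j) = 0" "(\<Sum>a\<in>UNIV. h * W i a j a) = 0"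
  by (simp_all add: traces flip: sum_distrib_left)

text \<open>Covers traces whose index is bound by the outer of two sums.\<close>

lemma trace_mult2:
  "(\<Sum>c\<in>UNIV. \<Sum>d\<in>UNIV. h d * W c d c x) = 0" "(\<Sum>c\<in>UNIV. \<Sum>d\<in>UNIV. h d * W c d x c) = 0"
  "(\<Sum>c\<in>UNIV. \<Sum>d\<in>UNIV. h d * W i c c d) = 0" "(\<Sum>c\<in>UNIV. \<Sum>d\<in>UNIV. h d * W i c d c) = 0"
  "(\<Sum>c\<in>UNIV. \<Sum>d\<in>UNIV. h d * W i c c x) = 0" "(\<Sum>c\<in>UNIV. \<Sum>d\<in>UNIV. h d * W i c x c) = 0"
  by (subst sum.swap, simp add: trace_mult)+

text \<open>Nine of the fifteen terms contain a self-contraction of \<open>W e f\<close>.\<close>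

lemma sum_wedge222:
  "(\<Sum>e\<in>UNIV. \<Sum>f\<in>UNIV. wedge222 P Q (W e f) a b c d e f)
    = (\<Sum>e\<in>UNIV. \<Sum>f\<in>UNIV. wedge22 P Q c d e f * W e f a b - wedge22 P Q b d e f * W e f a c
        + wedge22 P Q b c e f * W e f a d + wedge22 P Q a d e f * W e f b c
        - wedge22 P Q a c e f * W e f b d + wedge22 P Q a b e f * W e f c d)"
  by (simp add: wedge222_def sum.distrib sum_subtractf trace_mult trace_mult2)

text \<open>Write \<open>?ring\<close> for the left side of \<open>ring_variant\<close>. The six
  surviving sums add up to 4 \<open>R_check\<close> + 2 \<open>R_hat\<close> - 8
  \<open>?ring\<close>, and \<open>ring_variant\<close> supplies the other 2
  \<open>R_hat\<close>.\<close>

lemma cubic_trace_eq: "cubic_trace i j = 4 * R_check W i j + 4 * R_hat W i j - 8 * R_ring W i j"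
proof -
  define S where "S F = (\<Sum>b\<in>UNIV. \<Sum>c\<in>UNIV. \<Sum>d\<in>UNIV. \<Sum>e\<in>UNIV. \<Sum>f\<in>UNIV. F b c d e f)"
    for F :: "'n \<Rightarrow> 'n \<Rightarrow> 'n \<Rightarrow> 'n \<Rightarrow> 'n \<Rightarrow> real"
  have S_linear: "S (\<lambda>b c d e f. F b c d e f + G b c d e f) = S F + S G"
      "S (\<lambda>b c d e f. F b c d e f - G b c d e f) = S F - S G"
      "S (\<lambda>b c d e f. - F b c d e f) = - S F" for F G
    by (simp_all add: S_def sum.distrib sum_subtractf sum_negf)
  \<comment> \<open>Renamings and reorderings of the summation indices; the \<open>S_inner\<close>
    forms place the indices involved in traces innermost.\<close>
  have S_cd: "S (\<lambda>b c d e f. F b c d e f) = S (\<lambda>b c d e f. F b d c e f)"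
    and S_ef: "S (\<lambda>b c d e f. F b c d e f) = S (\<lambda>b c d e f. F b c d f e)"
    and S_cf_de: "S (\<lambda>b c d e f. F b c d e f) = S (\<lambda>b c d e f. F b f e d c)"
    and S_inner_db: "S (\<lambda>b c d e f. F b c d e f)
      = (\<Sum>c\<in>UNIV. \<Sum>e\<in>UNIV. \<Sum>f\<in>UNIV. \<Sum>d\<in>UNIV. \<Sum>b\<in>UNIV. F b c d e f)"
    and S_inner_cd: "S (\<lambda>b c d e f. F b c d e f)
      = (\<Sum>b\<in>UNIV. \<Sum>e\<in>UNIV. \<Sum>f\<in>UNIV. \<Sum>c\<in>UNIV. \<Sum>d\<in>UNIV. F b c d e f)"
    and S_inner_b: "S (\<lambda>b c d e f. F b c d e f)
      = (\<Sum>c\<in>UNIV. \<Sum>d\<in>UNIV. \<Sum>e\<in>UNIV. \<Sum>f\<in>UNIV. \<Sum>b\<in>UNIV. F b c d e f)"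
    and S_inner_d: "S (\<lambda>b c d e f. F b c d e f)
      = (\<Sum>b\<in>UNIV. \<Sum>c\<in>UNIV. \<Sum>e\<in>UNIV. \<Sum>f\<in>UNIV. \<Sum>d\<in>UNIV. F b c d e f)" for F
    unfolding S_def sum5_UNIV
    by (rule sum.reindex_bij_witness[where i = "\<lambda>(b, c, d, e, f). (b, d, c, e, f)" and j = "\<lambda>(b, c, d, e, f). (b, d, c, e, f)"]
        sum.reindex_bij_witness[where i = "\<lambda>(b, c, d, e, f). (b, c, d, f, e)" and j = "\<lambda>(b, c, d, e, f). (b, c, d, f, e)"]
        sum.reindex_bij_witness[where i = "\<lambda>(b, c, d, e, f). (b, f, e, d, c)" and j = "\<lambda>(b, c, d, e, f). (b, f, e, d, c)"]
        sum.reindex_bij_witness[where i = "\<lambda>(c, e, f, d, b). (b, c, d, e, f)" and j = "\<lambda>(b, c, d, e, f). (c, e, f, d, b)"]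
        sum.reindex_bij_witness[where i = "\<lambda>(b, e, f, c, d). (b, c, d, e, f)" and j = "\<lambda>(b, c, d, e, f). (b, e, f, c, d)"]
        sum.reindex_bij_witness[where i = "\<lambda>(c, d, e, f, b). (b, c, d, e, f)" and j = "\<lambda>(b, c, d, e, f). (c, d, e, f, b)"]
        sum.reindex_bij_witness[where i = "\<lambda>(b, c, e, f, d). (b, c, d, e, f)" and j = "\<lambda>(b, c, d, e, f). (b, c, e, f, d)"]; auto; fail)+
  let ?w = "\<lambda>b c d. wedge22 (W j b) (W c d)"
  have split: "cubic_trace i j = S (\<lambda>b c d e f. ?w b c d c d e f * W e f i b)
      - S (\<lambda>b c d e f. ?w b c d b d e f * W e f i c) + S (\<lambda>b c d e f. ?w b c d b c e f * W e f i d)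
      + S (\<lambda>b c d e f. ?w b c d i d e f * W e f b c) - S (\<lambda>b c d e f. ?w b c d i c e f * W e f b d)
      + S (\<lambda>b c d e f. ?w b c d i b e f * W e f c d)"
    unfolding S_linear[symmetric] by (simp only: cubic_trace_def cubic_def sum_wedge222 S_def)
  \<comment> \<open>Exchanging \<open>c\<close> and \<open>d\<close> relates the second sum to the
    third and the fourth to the fifth.\<close>
  have w_skew: "?w b d c = (\<lambda>p q r s. - ?w b c d p q r s)" for b c d
    by (simp add: wedge22_def fun_eq_iff skew_left[of d c])
  have B': "S (\<lambda>b c d e f. ?w b c d b c e f * W e f i d) = - S (\<lambda>b c d e f. ?w b c d b d e f * W e f i c)"
  proof -
    have "?w b d c b d e f * W e f i c = - (?w b c d b d e f * W e f i c)" for b c d e f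
      by (simp add: w_skew[of b d c])
    then show ?thesis by (subst S_cd) (simp only: S_linear(3))
  qed
  have C': "S (\<lambda>b c d e f. ?w b c d i c e f * W e f b d) = - S (\<lambda>b c d e f. ?w b c d i d e f * W e f b c)"
  proof -
    have "?w b d c i d e f * W e f b c = - (?w b c d i d e f * W e f b c)" for b c d e f
      by (simp add: w_skew[of b d c])
    then show ?thesis by (subst S_cd) (simp only: S_linear(3))
  qed
  let ?ring = "S (\<lambda>b c d e f. W j b d e * W c d b f * W e f i c)"
  \<comment> \<open>In each sum the six terms of \<open>wedge22\<close> lose those with a
    self-contraction: one survives in \<open>A\<close>, two in \<open>B\<close>, three in
    \<open>C\<close> and three in \<open>D\<close>.\<close>
  have A: "S (\<lambda>b c d e f. ?w b c d c d e f * W e f i b) = R_hat W i j"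
  proof -
    have "(\<Sum>c\<in>UNIV. \<Sum>d\<in>UNIV. ?w b c d c d e f * r) = (\<Sum>c\<in>UNIV. \<Sum>d\<in>UNIV. W j b c d * r * W c d e f)" for b e f r
    proof -
      have "?w b c d c d e f * r = W j b c d * r * W c d e f - W j b c e * r * W c d d f + W j b c f * r * W c d d e
          + W j b d e * r * W c d c f - W j b d f * r * W c d c e + W j b e f * r * W c d c d" for c d
        by (simp add: wedge22_def algebra_simps)
      then show ?thesis by (simp only: sum.distrib sum_subtractf trace_mult trace_mult2) simp
    qed
    then show ?thesis
      unfolding S_inner_cd by (simp add: R_hat_def pair_sym mult_ac)
  qed
  have B: "S (\<lambda>b c d e f. ?w b c d b d e f * W e f i c) = 2 * ?ring"
  proof -
    have "(\<Sum>d\<in>UNIV. \<Sum>b\<in>UNIV. ?w b c d b d e f * r)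
        = (\<Sum>d\<in>UNIV. \<Sum>b\<in>UNIV. W j b d e * r * W c d b f - W j b d f * r * W c d b e)" for c e f r
    proof -
      have "?w b c d b d e f * r = W c d e f * r * W j b b d - W c d d f * r * W j b b e + W c d d e * r * W j b b f
          + W j b d e * r * W c d b f - W j b d f * r * W c d b e + W j b e f * r * W c d b d" for b d
        by (simp add: wedge22_def algebra_simps)
      then show ?thesis by (simp only: sum.distrib sum_subtractf trace_mult trace_mult2) simp
    qed
    then have "S (\<lambda>b c d e f. ?w b c d b d e f * W e f i c)
        = S (\<lambda>b c d e f. W j b d e * W e f i c * W c d b f) - S (\<lambda>b c d e f. W j b d f * W e f i c * W c d b e)"
      unfolding S_linear(2)[symmetric] unfolding S_inner_db by (simp only:)
    also have "S (\<lambda>b c d e f. W j b d f * W e f i c * W c d b e) = - ?ring"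
    proof -
      have "W j b d e * W f e i c * W c d b f = - (W j b d e * W c d b f * W e f i c)" for b c d e f
        by (simp add: skew_left[of f e])
      then show ?thesis by (subst S_ef) (simp only: S_linear(3))
    qed
    finally show ?thesis by (simp add: mult_ac)
  qed
  have C: "S (\<lambda>b c d e f. ?w b c d i d e f * W e f b c) = R_check W i j - 2 * ?ring"
  proof -
    have "(\<Sum>d\<in>UNIV. ?w b c d i d e f * r)
        = (\<Sum>d\<in>UNIV. W j b i d * r * W c d e f + W j b d e * r * W c d i f - W j b d f * r * W c d i e)" for b c e f r
    proof -
      have "?w b c d i d e f * r = W j b i d * r * W c d e f - W j b i e * r * W c d d f + W j b i f * r * W c d d e
          + W j b d e * r * W c d i f - W j b d f * r * W c d i e + W j b e f * r * W c d i d" for d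
        by (simp add: wedge22_def algebra_simps)
      then show ?thesis by (simp add: sum.distrib sum_subtractf trace_mult)
    qed
    then have "S (\<lambda>b c d e f. ?w b c d i d e f * W e f b c)
        = S (\<lambda>b c d e f. W j b i d * W e f b c * W c d e f) + S (\<lambda>b c d e f. W j b d e * W e f b c * W c d i f)
          - S (\<lambda>b c d e f. W j b d f * W e f b c * W c d i e)"
      unfolding S_linear(1,2)[symmetric] unfolding S_inner_d by (simp only:)
    also have "S (\<lambda>b c d e f. W j b d f * W e f b c * W c d i e) = - S (\<lambda>b c d e f. W j b d e * W e f b c * W c d i f)"
    proof -
      have "W j b d e * W f e b c * W c d i f = - (W j b d e * W e f b c * W c d i f)" for b c d e f
        by (simp add: skew_left[of f e])
      then show ?thesis by (subst S_ef) (simp only: S_linear(3))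
    qed
    \<comment> \<open>Exchanging \<open>c\<close> with \<open>f\<close> and \<open>d\<close> with
      \<open>e\<close> yields the factors of \<open>?ring\<close> with one index pair reversed in
      each of the three, hence the sign.\<close>
    also have "S (\<lambda>b c d e f. W j b d e * W e f b c * W c d i f) = - ?ring"
    proof -
      have "W j b e d * W d c b f * W f e i c = - (W j b d e * W c d b f * W e f i c)" for b c d e f
        by (simp add: skew_right[of j b e d] skew_left[of d c] skew_left[of f e])
      moreover have "S (\<lambda>b c d e f. W j b d e * W e f b c * W c d i f) = S (\<lambda>b c d e f. W j b e d * W d c b f * W f e i c)"
        by (rule S_cf_de)
      ultimately show ?thesis by (simp only: S_linear(3))
    qed
    also have "S (\<lambda>b c d e f. W j b i d * W e f b c * W c d e f) = R_check W i j"
      unfolding S_def R_check_def sum5_UNIV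
    proof (rule sum.reindex_bij_witness[where i = "\<lambda>(d, b, e, f, c). (b, c, d, e, f)" and j = "\<lambda>(b, c, d, e, f). (d, b, e, f, c)"])
      fix x :: "'n \<times> 'n \<times> 'n \<times> 'n \<times> 'n"
      obtain b c d e f where x: "x = (b, c, d, e, f)" by (metis surj_pair)
      have "W i d b j * W e f c d * W e f c b = W j b i d * W e f b c * W c d e f"
        using pair_sym[of j b i d] skew_right[of i d b j] skew_right[of e f b c] pair_sym[of e f c d] by simp
      then show "(case case x of (b, c, d, e, f) \<Rightarrow> (d, b, e, f, c) of (u, v, a, b, c) \<Rightarrow> W i u v j * W a b c u * W a b c v)
          = (case x of (b, c, d, e, f) \<Rightarrow> W j b i d * W e f b c * W c d e f)"
        by (simp add: x)
    qed auto
    finally show ?thesis by simp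
  qed
  have D: "S (\<lambda>b c d e f. ?w b c d i b e f * W e f c d) = 2 * R_check W i j + R_hat W i j"
  proof -
    have "(\<Sum>b\<in>UNIV. ?w b c d i b e f * r)
        = (\<Sum>b\<in>UNIV. W j b i f * r * W c d b e - W j b i e * r * W c d b f + W j b e f * r * W c d i b)" for c d e f r
    proof -
      have "?w b c d i b e f * r = W c d e f * r * W j b i b - W j b i e * r * W c d b f + W j b i f * r * W c d b e
          + W c d i f * r * W j b b e - W c d i e * r * W j b b f + W j b e f * r * W c d i b" for b
        by (simp add: wedge22_def algebra_simps)
      then show ?thesis by (simp add: sum.distrib sum_subtractf trace_mult)
    qed
    then have "S (\<lambda>b c d e f. ?w b c d i b e f * W e f c d)
        = S (\<lambda>b c d e f. W j b i f * W e f c d * W c d b e) - S (\<lambda>b c d e f. W j b i e * W e f c d * W c d b f)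
          + S (\<lambda>b c d e f. W j b e f * W e f c d * W c d i b)"
      unfolding S_linear(1,2)[symmetric] unfolding S_inner_b by (simp only:)
    also have "S (\<lambda>b c d e f. W j b i f * W e f c d * W c d b e) = - S (\<lambda>b c d e f. W j b i e * W e f c d * W c d b f)"
    proof -
      have "W j b i e * W f e c d * W c d b f = - (W j b i e * W e f c d * W c d b f)" for b c d e f
        by (simp add: skew_left[of f e])
      then show ?thesis by (subst S_ef) (simp only: S_linear(3))
    qed
    also have "S (\<lambda>b c d e f. W j b i e * W e f c d * W c d b f) = - R_check W i j"
    proof -
      have "R_check W i j = S (\<lambda>b c d e f. - (W j b i e * W e f c d * W c d b f))"
        unfolding S_def R_check_def sum5_UNIV
      proof (rule sum.reindex_bij_witness[where i = "\<lambda>(b, c, d, e, f). (e, b, c, d, f)" and j = "\<lambda>(e, b, c, d, f). (b, c, d, e, f)"])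
        fix x :: "'n \<times> 'n \<times> 'n \<times> 'n \<times> 'n"
        obtain b c d e f where x: "x = (e, b, c, d, f)" by (metis surj_pair)
        have "- (W j b i e * W e f c d * W c d b f) = W i e b j * W c d f e * W c d f b"
          using pair_sym[of j b i e] skew_right[of i e b j] skew_right[of c d b f] skew_right[of c d f e] pair_sym[of c d e f]
          by simp
        then show "(case case x of (e, b, c, d, f) \<Rightarrow> (b, c, d, e, f) of (b, c, d, e, f) \<Rightarrow> - (W j b i e * W e f c d * W c d b f))
            = (case x of (u, v, a, b, c) \<Rightarrow> W i u v j * W a b c u * W a b c v)"
          by (simp add: x)
      qed auto
      then show ?thesis by (simp add: S_linear(3))
    qed
    also have "S (\<lambda>b c d e f. W j b e f * W e f c d * W c d i b) = R_hat W i j"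
      by (simp add: S_def R_hat_def pair_sym mult_ac)
    finally show ?thesis by simp
  qed
  have "?ring = R_ring W i j - 1/4 * R_hat W i j"
    unfolding S_def by (rule ring_variant)
  then show ?thesis
    by (simp add: split A B B' C C' D)
qed

end

section \<open>Einstein curvature tensors\<close>

text \<open>The sign is the one for which the component 1221 is 1, so that the trace over the first
  and last slots is positive.\<close>

definition sphere_tensor :: "'n tensor4" where
  "sphere_tensor i j k l =
     (if i = l then if j = k then 1 else 0 else 0) - (if i = k then if j = l then 1 else 0 else 0)"

lemma sphere_tensor_symmetries:
  "sphere_tensor b a c d = - sphere_tensor a b c d"
  "sphere_tensor a b d c = - sphere_tensor a b c d"
  "sphere_tensor a b c d + sphere_tensor b c a d + sphere_tensor c a b d = 0"
  by (auto simp: sphere_tensor_def)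

lemma if_zero_mult:
  "x * (if P then y else 0) = (if P then x * y else (0::real))"
  "(if P then y else 0) * x = (if P then y * x else (0::real))"
  by simp_all

lemma sum_if_const:
  "(\<Sum>v\<in>S. if P then F v else 0) = (if P then sum F S else (0::real))"
  by simp

text \<open>Contraction with the sphere tensor only transposes \<open>X\<close> or takes its trace,
  so the expansion in \<open>k\<close> leads back to contractions of lower degree.\<close>

lemma sphere_tensor_contract:
  fixes X :: "'n::finite \<Rightarrow> 'n \<Rightarrow> real"
  shows "(\<Sum>u\<in>UNIV. \<Sum>v\<in>UNIV. X u v * sphere_tensor c d u v) = X d c - X c d"
    and "(\<Sum>u\<in>UNIV. \<Sum>v\<in>UNIV. sphere_tensor c d u v * X u v) = X d c - X c d"
    and "(\<Sum>u\<in>UNIV. \<Sum>v\<in>UNIV. sphere_tensor c u v d * X u v)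
      = (if c = d then \<Sum>u\<in>UNIV. X u u else 0) - X d c"
    and "(\<Sum>u\<in>UNIV. \<Sum>v\<in>UNIV. X u v * sphere_tensor c u d v)
      = X d c - (if c = d then \<Sum>u\<in>UNIV. X u u else 0)"
    and "(\<Sum>u\<in>UNIV. \<Sum>v\<in>UNIV. sphere_tensor c u d v * X u v)
      = X d c - (if c = d then \<Sum>u\<in>UNIV. X u u else 0)"
  by (simp_all add: sphere_tensor_def algebra_simps if_zero_mult sum_if_const sum_subtractf cong: if_cong)

lemma sphere_tensor_traces:
  fixes p q :: "'n::finite"
  shows "(\<Sum>a\<in>UNIV. sphere_tensor p a a q) = (if p = q then real CARD('n) - 1 else 0)"
    and "(\<Sum>a\<in>UNIV. sphere_tensor p a q a) = (if p = q then 1 - real CARD('n) else 0)"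
    and "(\<Sum>a\<in>UNIV. sphere_tensor a p q a) = (if p = q then real CARD('n) - 1 else 0)"
  by (cases "p = q"; simp add: sphere_tensor_def sum_subtractf sum_negf)+

section \<open>Quadratic contractions\<close>

context algebraic_curvature
begin

lemma R_bar_sym: "R_bar W j i = R_bar W i j"
  by (simp add: R_bar_def mult.commute)

lemma norm_sq_eq_trace: "norm_sq W = (\<Sum>a\<in>UNIV. R_bar W a a)"
  by (simp add: norm_sq_def R_bar_def)

text \<open>Reading the four indices backwards is a symmetry of \<open>W\<close>, which turns the
  contraction over the first three slots into \<open>R_bar\<close>. The resulting linearity in
  \<open>R_bar\<close> serves both the trace-free and the super-Einstein case.\<close>

lemma R_check_eq: "R_check W i j = (\<Sum>u\<in>UNIV. \<Sum>v\<in>UNIV. W i u v j * R_bar W u v)"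
proof -
  have "(\<Sum>a\<in>UNIV. \<Sum>b\<in>UNIV. \<Sum>c\<in>UNIV. W a b c u * W a b c v) = R_bar W u v" for u v
  proof -
    have "(\<Sum>a\<in>UNIV. \<Sum>b\<in>UNIV. \<Sum>c\<in>UNIV. W a b c u * W a b c v)
        = (\<Sum>(a, b, c)\<in>UNIV. W a b c u * W a b c v)"
      by (simp add: sum.cartesian_product flip: UNIV_Times_UNIV)
    also have "\<dots> = (\<Sum>(a, b, c)\<in>UNIV. W u a b c * W v a b c)"
    proof (rule sum.reindex_bij_witness[where i = "\<lambda>(c, b, a). (a, b, c)" and j = "\<lambda>(a, b, c). (c, b, a)"])
      fix x :: "'n \<times> 'n \<times> 'n"
      obtain a b c where x: "x = (a, b, c)" by (metis surj_pair)
      have "W p c b a = W a b c p" for p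
        using pair_sym[of p c b a] skew_left[of b a p c] skew_right[of a b c p] by simp
      then show "(case case x of (a, b, c) \<Rightarrow> (c, b, a) of (a, b, c) \<Rightarrow> W u a b c * W v a b c)
          = (case x of (a, b, c) \<Rightarrow> W a b c u * W a b c v)"
        by (simp add: x)
    qed auto
    also have "\<dots> = R_bar W u v"
      by (simp add: R_bar_def sum.cartesian_product flip: UNIV_Times_UNIV)
    finally show ?thesis .
  qed
  then show ?thesis
    by (simp add: R_check_def mult.assoc flip: sum_distrib_left)
qed

text \<open>This is \<open>half_bianchi\<close> in \<open>b\<close> and \<open>d\<close>, with
  \<open>W j c\<close> as the skew factor.\<close>

lemma half_R_bar:
  "(\<Sum>b\<in>UNIV. \<Sum>c\<in>UNIV. \<Sum>d\<in>UNIV. W i b c d * W j c b d) = 1/2 * R_bar W i j"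
proof -
  have "(\<Sum>b\<in>UNIV. \<Sum>c\<in>UNIV. \<Sum>d\<in>UNIV. W i b c d * W j c b d)
      = (\<Sum>c\<in>UNIV. \<Sum>b\<in>UNIV. \<Sum>d\<in>UNIV. W i b c d * W j c b d)"
    by (rule sum.swap)
  also have "\<dots> = (\<Sum>c\<in>UNIV. 1/2 * (\<Sum>b\<in>UNIV. \<Sum>d\<in>UNIV. W i c b d * W j c b d))"
    by (simp only: half_bianchi[of "W j c" i c for c, OF skew_right])
  finally show ?thesis by (simp add: R_bar_def flip: sum_divide_distrib)
qed

text \<open>The Bianchi identity reduces this contraction to \<open>R_bar\<close> minus that of
  \<open>half_R_bar\<close>.\<close>

lemma half_R_bar':
  "(\<Sum>b\<in>UNIV. \<Sum>c\<in>UNIV. \<Sum>d\<in>UNIV. W i b c d * W j d c b) = 1/2 * R_bar W i j"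
proof -
  have eq: "W i b c d * W j d c b = W i b c d * W j b c d - W i b c d * W j c b d" for b c d
  proof -
    have "W j d c b = W j b c d - W j c b d"
      using bianchi[of j b c d] skew_left[of j c b d] pair_sym[of b c j d] skew_right[of j d b c] by simp
    then show ?thesis by (simp only: right_diff_distrib)
  qed
  have "(\<Sum>b\<in>UNIV. \<Sum>c\<in>UNIV. \<Sum>d\<in>UNIV. W i b c d * W j d c b)
      = (\<Sum>b\<in>UNIV. \<Sum>c\<in>UNIV. \<Sum>d\<in>UNIV. W i b c d * W j b c d - W i b c d * W j c b d)"
    by (intro sum.cong refl eq)
  also have "\<dots> = R_bar W i j - 1/2 * R_bar W i j"
    by (simp add: sum_subtractf half_R_bar) (simp add: R_bar_def)
  finally show ?thesis by simp
qed

end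

context weyl_tensor
begin

text \<open>The trace of \<open>cubic_trace_eq\<close> determines the multiple of the metric. There
  \<open>R_check\<close> drops out: its trace contracts \<open>R_bar\<close> with the vanishing
  trace of \<open>W\<close>.\<close>

lemma weyl_identity:
  assumes "CARD('n) = 6"
  shows "12 * R_check W i j + 12 * R_hat W i j - 24 * R_ring W i j
    = (if i = j then 2 * R_hat_scalar W - 4 * R_ring_scalar W else 0)"
proof -
  have "(\<Sum>k\<in>UNIV. R_check W k k) = (\<Sum>k\<in>UNIV. \<Sum>u\<in>UNIV. \<Sum>v\<in>UNIV. R_bar W u v * W k u v k)"
    by (simp add: R_check_eq mult.commute)
  also have "\<dots> = (\<Sum>u\<in>UNIV. \<Sum>k\<in>UNIV. \<Sum>v\<in>UNIV. R_bar W u v * W k u v k)"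
    by (rule sum.swap)
  also have "\<dots> = (\<Sum>u\<in>UNIV. \<Sum>v\<in>UNIV. \<Sum>k\<in>UNIV. R_bar W u v * W k u v k)"
    by (intro sum.cong refl sum.swap)
  finally have "(\<Sum>k\<in>UNIV. R_check W k k) = 0"
    by (simp add: trace_mult)
  moreover have "(\<Sum>k\<in>UNIV. R_hat W k k) = R_hat_scalar W" "(\<Sum>k\<in>UNIV. R_ring W k k) = R_ring_scalar W"
    by (simp_all add: R_hat_def R_ring_def R_hat_scalar_def R_ring_scalar_def)
  ultimately have "(\<Sum>k\<in>UNIV. cubic_trace k k) = 4 * R_hat_scalar W - 8 * R_ring_scalar W"
    by (simp add: cubic_trace_eq sum.distrib sum_subtractf flip: sum_distrib_left)
  then show ?thesis
    using cubic_trace_identity[OF assms, of i j] cubic_trace_eq[of i j] by (simp split: if_splits)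
qed

section \<open>Contractions of \<open>W + k * sphere_tensor\<close> in powers of
  \<open>k\<close>\<close>

context
  fixes k :: real and R :: "'n tensor4"
  assumes R: "\<And>a b c d. R a b c d = W a b c d + k * sphere_tensor a b c d"
    and card6: "CARD('n) = 6"
begin

lemma R_curvature: "algebraic_curvature R"
proof
  show "R b a c d = - R a b c d" for a b c d
    using skew_left[of b a c d] sphere_tensor_symmetries(1)[of b a c d] by (simp add: R)
  show "R a b d c = - R a b c d" for a b c d
    using skew_right[of a b d c] sphere_tensor_symmetries(2)[of a b d c] by (simp add: R)
  show "R a b c d + R b c a d + R c a b d = 0" for a b c d
  proof -
    have "R a b c d + R b c a d + R c a b d = (W a b c d + W b c a d + W c a b d)
        + k * (sphere_tensor a b c d + sphere_tensor b c a d + sphere_tensor c a b d)"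
      by (simp add: R algebra_simps)
    then show ?thesis by (simp add: bianchi sphere_tensor_symmetries(3))
  qed
qed

text \<open>The cross terms are traces of \<open>W\<close> and vanish; 10 is 2 * (6 - 1).\<close>

lemma R_bar_sum: "R_bar R i j = R_bar W i j + (if i = j then 10 * k\<^sup>2 else 0)"
proof -
  have WG: "(\<Sum>a\<in>UNIV. \<Sum>b\<in>UNIV. \<Sum>c\<in>UNIV. W p a b c * sphere_tensor q a b c) = 0" for p q
    by (simp add: sphere_tensor_contract sum_subtractf traces)
  have GG: "(\<Sum>a\<in>UNIV. \<Sum>b\<in>UNIV. \<Sum>c\<in>UNIV. sphere_tensor p a b c * sphere_tensor q a b c)
      = (if p = q then 10 else 0)" for p q :: 'n
    by (simp add: sphere_tensor_contract sum_subtractf sphere_tensor_traces card6)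
  have "R_bar R i j = R_bar W i j + k * (\<Sum>a\<in>UNIV. \<Sum>b\<in>UNIV. \<Sum>c\<in>UNIV. W i a b c * sphere_tensor j a b c)
      + k * (\<Sum>a\<in>UNIV. \<Sum>b\<in>UNIV. \<Sum>c\<in>UNIV. W j a b c * sphere_tensor i a b c)
      + k\<^sup>2 * (\<Sum>a\<in>UNIV. \<Sum>b\<in>UNIV. \<Sum>c\<in>UNIV. sphere_tensor i a b c * sphere_tensor j a b c)"
    by (simp add: R_bar_def R algebra_simps sum.distrib power2_eq_square sum_distrib_left)
  then show ?thesis by (simp add: WG GG)
qed

lemma norm_sq_sum: "norm_sq R = norm_sq W + 60 * k\<^sup>2"
  using card6 by (simp add: norm_sq_eq_trace algebraic_curvature.norm_sq_eq_trace[OF R_curvature]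
      R_bar_sum sum.distrib)

text \<open>In the pure term, 50 is the 10 of \<open>R_bar_sum\<close> times the Ricci constant 5 of
  the unit sphere.\<close>

lemma R_check_sum:
  "R_check R i j = R_check W i j - k * R_bar W i j + (if i = j then k * norm_sq W + 50 * k ^ 3 else 0)"
proof -
  have "R_check R i j = (\<Sum>u\<in>UNIV. \<Sum>v\<in>UNIV. W i u v j * R_bar W u v)
      + k * (\<Sum>u\<in>UNIV. \<Sum>v\<in>UNIV. sphere_tensor i u v j * R_bar W u v)
      + (\<Sum>u\<in>UNIV. \<Sum>v\<in>UNIV. W i u v j * (if u = v then 10 * k\<^sup>2 else 0))
      + k * (\<Sum>u\<in>UNIV. \<Sum>v\<in>UNIV. sphere_tensor i u v j * (if u = v then 10 * k\<^sup>2 else 0))"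
    by (simp add: algebraic_curvature.R_check_eq[OF R_curvature] R R_bar_sum algebra_simps sum.distrib sum_distrib_left)
  also have "(\<Sum>u\<in>UNIV. \<Sum>v\<in>UNIV. W i u v j * (if u = v then 10 * k\<^sup>2 else 0)) = 0"
    by (simp add: if_zero_mult traces flip: sum_distrib_right)
  also have "(\<Sum>u\<in>UNIV. \<Sum>v\<in>UNIV. W i u v j * R_bar W u v) = R_check W i j"
    by (rule R_check_eq[symmetric])
  also have "(\<Sum>u\<in>UNIV. \<Sum>v\<in>UNIV. sphere_tensor i u v j * R_bar W u v)
      = (if i = j then norm_sq W else 0) - R_bar W i j"
    by (simp add: sphere_tensor_contract norm_sq_eq_trace R_bar_sym[of j i])
  also have "(\<Sum>u\<in>UNIV. \<Sum>v\<in>UNIV. sphere_tensor i u v j * (if u = v then 10 * k\<^sup>2 else 0))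
      = (if i = j then 50 * k\<^sup>2 else 0)"
    by (simp add: sphere_tensor_contract card6)
  finally show ?thesis
    by (simp add: algebra_simps power2_eq_square power3_eq_cube)
qed

text \<open>The coefficient -6 collects -4 from the two cross terms of the inner sum over
  \<open>u\<close>, \<open>v\<close> and -2 from the outer sphere tensor; -20 is -2 * 10.\<close>

lemma R_hat_sum:
  "R_hat R i j = R_hat W i j - 6 * k * R_bar W i j - (if i = j then 20 * k ^ 3 else 0)"
proof -
  define H where "H j b c d = (\<Sum>u\<in>UNIV. \<Sum>v\<in>UNIV. W j b u v * W c d u v)" for j b c d
  let ?G = sphere_tensor
  have "(\<Sum>u\<in>UNIV. \<Sum>v\<in>UNIV. R j b u v * R c d u v) = H j b c d
      + k * (\<Sum>u\<in>UNIV. \<Sum>v\<in>UNIV. W j b u v * ?G c d u v) + k * (\<Sum>u\<in>UNIV. \<Sum>v\<in>UNIV. ?G j b u v * W c d u v)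
      + k\<^sup>2 * (\<Sum>u\<in>UNIV. \<Sum>v\<in>UNIV. ?G j b u v * ?G c d u v)" for b c d
    by (simp add: H_def R algebra_simps sum.distrib power2_eq_square sum_distrib_left)
  moreover have "(\<Sum>u\<in>UNIV. \<Sum>v\<in>UNIV. W j b u v * ?G c d u v) = - 2 * W j b c d"
      "(\<Sum>u\<in>UNIV. \<Sum>v\<in>UNIV. ?G j b u v * W c d u v) = - 2 * W j b c d"
      "(\<Sum>u\<in>UNIV. \<Sum>v\<in>UNIV. ?G j b u v * ?G c d u v) = - 2 * ?G j b c d" for b c d
    using skew_right[of j b d c] skew_left[of b j c d] pair_sym[of c d j b] pair_sym[of c d b j]
      sphere_tensor_symmetries(2)[of j b d c]
    by (simp_all add: sphere_tensor_contract)
  ultimately have inner: "(\<Sum>u\<in>UNIV. \<Sum>v\<in>UNIV. R j b u v * R c d u v)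
      = H j b c d - 4 * k * W j b c d - 2 * k\<^sup>2 * ?G j b c d" for b c d
    by simp
  have "R_hat R i j = (\<Sum>b\<in>UNIV. \<Sum>c\<in>UNIV. \<Sum>d\<in>UNIV. R i b c d * (\<Sum>u\<in>UNIV. \<Sum>v\<in>UNIV. R j b u v * R c d u v))"
    by (simp add: R_hat_def sum_distrib_left mult.assoc)
  also have "\<dots> = (\<Sum>b\<in>UNIV. \<Sum>c\<in>UNIV. \<Sum>d\<in>UNIV. W i b c d * H j b c d)
      - 4 * k * (\<Sum>b\<in>UNIV. \<Sum>c\<in>UNIV. \<Sum>d\<in>UNIV. W i b c d * W j b c d)
      - 2 * k\<^sup>2 * (\<Sum>b\<in>UNIV. \<Sum>c\<in>UNIV. \<Sum>d\<in>UNIV. W i b c d * ?G j b c d)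
      + k * (\<Sum>b\<in>UNIV. \<Sum>c\<in>UNIV. \<Sum>d\<in>UNIV. ?G i b c d * H j b c d)
      - 4 * k\<^sup>2 * (\<Sum>b\<in>UNIV. \<Sum>c\<in>UNIV. \<Sum>d\<in>UNIV. ?G i b c d * W j b c d)
      - 2 * k ^ 3 * (\<Sum>b\<in>UNIV. \<Sum>c\<in>UNIV. \<Sum>d\<in>UNIV. ?G i b c d * ?G j b c d)"
    unfolding inner
    by (simp add: R algebra_simps sum.distrib sum_subtractf power2_eq_square power3_eq_cube sum_distrib_left)
  also have "(\<Sum>b\<in>UNIV. \<Sum>c\<in>UNIV. \<Sum>d\<in>UNIV. W i b c d * H j b c d) = R_hat W i j"
    by (simp add: R_hat_def H_def sum_distrib_left mult.assoc)
  also have "(\<Sum>b\<in>UNIV. \<Sum>c\<in>UNIV. \<Sum>d\<in>UNIV. W i b c d * W j b c d) = R_bar W i j"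
    by (simp add: R_bar_def)
  also have "(\<Sum>b\<in>UNIV. \<Sum>c\<in>UNIV. \<Sum>d\<in>UNIV. W i b c d * ?G j b c d) = 0"
    by (simp add: sphere_tensor_contract sum_subtractf traces)
  also have "(\<Sum>b\<in>UNIV. \<Sum>c\<in>UNIV. \<Sum>d\<in>UNIV. ?G i b c d * W j b c d) = 0"
    by (simp add: sphere_tensor_contract sum_subtractf traces)
  also have "(\<Sum>b\<in>UNIV. \<Sum>c\<in>UNIV. \<Sum>d\<in>UNIV. ?G i b c d * ?G j b c d) = (if i = j then 10 else 0)"
    by (simp add: sphere_tensor_contract sum_subtractf sphere_tensor_traces card6)
  also have "(\<Sum>b\<in>UNIV. \<Sum>c\<in>UNIV. \<Sum>d\<in>UNIV. ?G i b c d * H j b c d) = - 2 * R_bar W i j"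
  proof -
    have "(\<Sum>b\<in>UNIV. H j b b i) = - R_bar W i j" "(\<Sum>b\<in>UNIV. H j b i b) = R_bar W i j"
      by (simp_all add: H_def R_bar_def skew_left[of _ i] sum_negf mult.commute)
    then show ?thesis by (simp add: sphere_tensor_contract sum_subtractf)
  qed
  finally show ?thesis by simp
qed

text \<open>The coefficient 3/2 collects 1/2 from each of the two inner cross terms and 1/2 from the
  outer sphere tensor, all by \<open>half_R_bar'\<close>.\<close>

lemma R_ring_sum:
  "R_ring R i j = R_ring W i j + 3/2 * k * R_bar W i j - (if i = j then 20 * k ^ 3 else 0)"
proof -
  define L where "L j c b d = (\<Sum>u\<in>UNIV. \<Sum>v\<in>UNIV. W j u c v * W b u d v)" for j c b d
  let ?G = sphere_tensor
  \<comment> \<open>This is the contraction of two sphere tensors; 4 is 6 - 2.\<close>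
  define E where "E c b d = (if j = b then if c = d then 1 else 0 else 0) + (if j = c then if b = d then 4 else 0 else (0::real))"
    for c b d
  have "(\<Sum>u\<in>UNIV. \<Sum>v\<in>UNIV. R j u c v * R b u d v) = L j c b d
      + k * (\<Sum>u\<in>UNIV. \<Sum>v\<in>UNIV. W j u c v * ?G b u d v) + k * (\<Sum>u\<in>UNIV. \<Sum>v\<in>UNIV. ?G j u c v * W b u d v)
      + k\<^sup>2 * (\<Sum>u\<in>UNIV. \<Sum>v\<in>UNIV. ?G j u c v * ?G b u d v)" for b c d
    by (simp add: L_def R algebra_simps sum.distrib power2_eq_square sum_distrib_left)
  moreover have "(\<Sum>u\<in>UNIV. \<Sum>v\<in>UNIV. W j u c v * ?G b u d v) = W j d c b"
      "(\<Sum>u\<in>UNIV. \<Sum>v\<in>UNIV. ?G j u c v * W b u d v) = W j d c b" for b c d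
    using pair_sym[of b c d j] skew_left[of d j b c] skew_right[of j d b c]
    by (simp_all add: sphere_tensor_contract traces)
  moreover have "(\<Sum>u\<in>UNIV. \<Sum>v\<in>UNIV. ?G j u c v * ?G b u d v) = E c b d" for b c d
    by (simp add: sphere_tensor_contract sphere_tensor_traces card6) (auto simp: sphere_tensor_def E_def)
  ultimately have inner: "(\<Sum>u\<in>UNIV. \<Sum>v\<in>UNIV. R j u c v * R b u d v)
      = L j c b d + 2 * k * W j d c b + k\<^sup>2 * E c b d" for b c d
    by simp
  have "R_ring R i j = (\<Sum>b\<in>UNIV. \<Sum>c\<in>UNIV. \<Sum>d\<in>UNIV. R i b c d * (\<Sum>u\<in>UNIV. \<Sum>v\<in>UNIV. R j u c v * R b u d v))"
    by (simp add: R_ring_def sum_distrib_left mult.assoc)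
  also have "\<dots> = (\<Sum>b\<in>UNIV. \<Sum>c\<in>UNIV. \<Sum>d\<in>UNIV. W i b c d * L j c b d)
      + 2 * k * (\<Sum>b\<in>UNIV. \<Sum>c\<in>UNIV. \<Sum>d\<in>UNIV. W i b c d * W j d c b)
      + k\<^sup>2 * (\<Sum>b\<in>UNIV. \<Sum>c\<in>UNIV. \<Sum>d\<in>UNIV. W i b c d * E c b d)
      + k * (\<Sum>b\<in>UNIV. \<Sum>c\<in>UNIV. \<Sum>d\<in>UNIV. ?G i b c d * L j c b d)
      + 2 * k\<^sup>2 * (\<Sum>b\<in>UNIV. \<Sum>c\<in>UNIV. \<Sum>d\<in>UNIV. ?G i b c d * W j d c b)
      + k ^ 3 * (\<Sum>b\<in>UNIV. \<Sum>c\<in>UNIV. \<Sum>d\<in>UNIV. ?G i b c d * E c b d)"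
    unfolding inner
    by (simp add: R algebra_simps sum.distrib power2_eq_square power3_eq_cube sum_distrib_left)
  also have "(\<Sum>b\<in>UNIV. \<Sum>c\<in>UNIV. \<Sum>d\<in>UNIV. W i b c d * L j c b d) = R_ring W i j"
    by (simp add: R_ring_def L_def sum_distrib_left mult.assoc)
  also have "(\<Sum>b\<in>UNIV. \<Sum>c\<in>UNIV. \<Sum>d\<in>UNIV. W i b c d * W j d c b) = 1/2 * R_bar W i j"
    by (rule half_R_bar')
  also have "(\<Sum>b\<in>UNIV. \<Sum>c\<in>UNIV. \<Sum>d\<in>UNIV. W i b c d * E c b d) = 0"
    by (simp add: E_def distrib_left sum.distrib if_zero_mult sum_if_const traces cong: if_cong flip: sum_distrib_right)
  also have "(\<Sum>b\<in>UNIV. \<Sum>c\<in>UNIV. \<Sum>d\<in>UNIV. ?G i b c d * W j d c b) = 0"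
    by (simp add: sphere_tensor_contract sum_subtractf sum_negf traces)
  also have "(\<Sum>b\<in>UNIV. \<Sum>c\<in>UNIV. \<Sum>d\<in>UNIV. ?G i b c d * E c b d) = - (if i = j then 20 else 0)"
    by (simp add: sphere_tensor_contract sum_subtractf) (auto simp: E_def sum.distrib card6)
  also have "(\<Sum>b\<in>UNIV. \<Sum>c\<in>UNIV. \<Sum>d\<in>UNIV. ?G i b c d * L j c b d) = 1/2 * R_bar W i j"
  proof -
    have "(\<Sum>b\<in>UNIV. L j i b b) = (\<Sum>u\<in>UNIV. \<Sum>b\<in>UNIV. \<Sum>v\<in>UNIV. W j u i v * W b u b v)"
      unfolding L_def by (rule sum.swap)
    also have "\<dots> = (\<Sum>u\<in>UNIV. \<Sum>v\<in>UNIV. \<Sum>b\<in>UNIV. W j u i v * W b u b v)"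
      by (intro sum.cong refl sum.swap)
    finally have "(\<Sum>b\<in>UNIV. L j i b b) = 0" by (simp add: trace_mult)
    moreover have "(\<Sum>b\<in>UNIV. L j b b i) = 1/2 * R_bar W i j"
    proof -
      have "L j b b i = (\<Sum>v\<in>UNIV. \<Sum>u\<in>UNIV. W i v b u * W j u b v)" for b
        unfolding L_def by (subst sum.swap) (simp add: pair_sym[of b u i v for u v] mult.commute)
      then have "(\<Sum>b\<in>UNIV. L j b b i) = (\<Sum>b\<in>UNIV. \<Sum>v\<in>UNIV. \<Sum>u\<in>UNIV. W i v b u * W j u b v)"
        by (simp only:)
      also have "\<dots> = (\<Sum>v\<in>UNIV. \<Sum>b\<in>UNIV. \<Sum>u\<in>UNIV. W i v b u * W j u b v)"
        by (rule sum.swap)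
      finally show ?thesis by (simp only: half_R_bar')
    qed
    ultimately show ?thesis by (simp add: sphere_tensor_contract sum_subtractf)
  qed
  finally show ?thesis by simp
qed

end

end

text \<open>By the expansions the three cubic contractions contribute (-12 - 72 - 36)
  \<open>k\<close> = -120 \<open>k\<close> times \<open>R_bar W\<close>. Adding 24
  \<open>\<rho>\<close> = 120 \<open>k\<close> times \<open>R_bar R\<close> cancels this, which is
  the origin of the first term. On the right, the coefficient of \<open>k * norm_sq W\<close> is 30
  - 6 - 12 = 12, as on the left.\<close>

lemma einstein_tensor_identity:
  fixes R :: "'n::finite tensor4"
  assumes "algebraic_curvature R" and einstein: "\<And>i j. (\<Sum>a\<in>UNIV. R a i j a) = (if i = j then \<rho> else 0)"
    and card6: "CARD('n) = 6"
  shows "24 * \<rho> * R_bar R i j + 12 * R_check R i j + 12 * R_hat R i j - 24 * R_ring R i j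
    = (if i = j then 6 * \<rho> * norm_sq R - 4 * R_ring_scalar R + 2 * R_hat_scalar R else 0)"
proof -
  interpret R: algebraic_curvature R by fact
  \<comment> \<open>The unit sphere of dimension six has Ricci constant 5, so this choice makes
    \<open>W\<close> trace-free.\<close>
  define k where "k = \<rho> / 5"
  define W where "W a b c d = R a b c d - k * sphere_tensor a b c d" for a b c d
  interpret W: weyl_tensor W
  proof
    show "W b a c d = - W a b c d" for a b c d
      using R.skew_left[of b a c d] sphere_tensor_symmetries(1)[of b a c d] by (simp add: W_def)
    show "W a b d c = - W a b c d" for a b c d
      using R.skew_right[of a b d c] sphere_tensor_symmetries(2)[of a b d c] by (simp add: W_def)
    show "W a b c d + W b c a d + W c a b d = 0" for a b c d
    proof -
      have "W a b c d + W b c a d + W c a b d = (R a b c d + R b c a d + R c a b d)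
          - k * (sphere_tensor a b c d + sphere_tensor b c a d + sphere_tensor c a b d)"
        by (simp add: W_def algebra_simps)
      then show ?thesis by (simp add: R.bianchi sphere_tensor_symmetries(3))
    qed
    show "(\<Sum>a\<in>UNIV. W a i j a) = 0" for i j
    proof -
      have "(\<Sum>a\<in>UNIV. W a i j a) = (\<Sum>a\<in>UNIV. R a i j a) - k * (\<Sum>a\<in>UNIV. sphere_tensor a i j a)"
        by (simp add: W_def sum_subtractf sum_distrib_left)
      then show ?thesis by (simp add: einstein sphere_tensor_traces card6 k_def)
    qed
  qed
  have eq: "R a b c d = W a b c d + k * sphere_tensor a b c d" for a b c d
    by (simp add: W_def)
  note sums = W.R_bar_sum[OF eq card6] W.norm_sq_sum[OF eq card6] W.R_check_sum[OF eq card6]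
    W.R_hat_sum[OF eq card6] W.R_ring_sum[OF eq card6]
  have scalars: "R_hat_scalar T = (\<Sum>a\<in>UNIV. R_hat T a a)" "R_ring_scalar T = (\<Sum>a\<in>UNIV. R_ring T a a)"
    for T :: "'n tensor4"
    by (simp_all add: R_hat_def R_ring_def R_hat_scalar_def R_ring_scalar_def)
  have "R_hat_scalar R = R_hat_scalar W - 6 * k * norm_sq W - 120 * k ^ 3"
    "R_ring_scalar R = R_ring_scalar W + 3/2 * k * norm_sq W - 120 * k ^ 3"
    unfolding scalars W.norm_sq_eq_trace
    by (simp_all add: sums sum.distrib sum_subtractf card6 flip: sum_distrib_left sum_divide_distrib)
  then show ?thesis
    using W.weyl_identity[OF card6, of i j]
    by (simp add: sums k_def algebra_simps power2_eq_square power3_eq_cube split: if_splits)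
qed

section \<open>From frame components back to the manifold\<close>

context levi_civita
begin

lemma curv_comp_algebraic:
  assumes frame: "orthonormal_frame M A g W e" and p: "p \<in> W"
  shows "algebraic_curvature (curv_comp M A g D e p)"
proof -
  have W: "openin M W" and e: "e i \<in> vector_fields M A W" for i
    using frame by (auto simp: orthonormal_frame_def)
  note v = vector_field_at[OF e p]
  show ?thesis
    unfolding curv_comp_def
  proof
    show "g p (curvature M A D (e b) (e a) (e c) p) (e d p) = - g p (curvature M A D (e a) (e b) (e c) p) (e d p)"
      for a b c d by (rule metric_curvature_swap[OF W p e e e v])
    show "g p (curvature M A D (e a) (e b) (e d) p) (e c p) = - g p (curvature M A D (e a) (e b) (e c) p) (e d p)"
      for a b c d by (rule metric_curvature_skew[OF W p e e e e])
    show "g p (curvature M A D (e a) (e b) (e c) p) (e d p) + g p (curvature M A D (e b) (e c) (e a) p) (e d p)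
        + g p (curvature M A D (e c) (e a) (e b) p) (e d p) = 0" for a b c d
      by (rule first_bianchi[OF W p e e e v])
  qed
qed

lemma einstein_curv_comp_trace:
  assumes "einstein M A g D" and frame: "orthonormal_frame M A g W e" and p: "p \<in> W"
  shows "(\<Sum>a\<in>UNIV. curv_comp M A g D e p a i j a)
    = (if i = j then scalar_curv M A g D e p / real CARD('n) else 0)"
proof -
  have "e k \<in> vector_fields M A W" "g p (e i p) (e j p) = (if i = j then 1 else 0)" for k
    using frame p by (auto simp: orthonormal_frame_def)
  moreover from this have "ricci M A g D e (e i) (e j) p = scalar_curv M A g D e p / real CARD('n) * g p (e i p) (e j p)"
    using assms unfolding einstein_def by blast
  ultimately show ?thesis by (simp add: ricci_def curv_comp_def)
qed

end

text \<open>In \<open>R_check_eq\<close> a multiple of the metric in place of \<open>R_bar\<close>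
  leaves \<open>r\<close> times the Ricci trace.\<close>

lemma (in algebraic_curvature) super_einstein_check:
  assumes "\<And>i j. (\<Sum>a\<in>UNIV. W a i j a) = (if i = j then \<rho> else 0)"
    and "\<And>i j. R_bar W i j = (if i = j then r else 0)"
  shows "R_check W i j = (if i = j then \<rho> * r else 0)"
proof -
  have "W i u u j = W u i j u" for u
    using skew_left[of i u u j] skew_right[of u i u j] by simp
  then have "R_check W i j = r * (\<Sum>u\<in>UNIV. W u i j u)"
    by (simp add: R_check_eq assms(2) if_zero_mult sum_distrib_left mult.commute)
  then show ?thesis by (simp add: assms(1))
qed

theorem theoremB:
  fixes M :: "'a topology"
    and A :: "('a, 6) chart set"
    and g :: "'a \<Rightarrow> 'a tvec \<Rightarrow> 'a tvec \<Rightarrow> real"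
    and D :: "'a vfield \<Rightarrow> 'a vfield \<Rightarrow> 'a vfield"
  assumes "levi_civita M A g D"
  shows
    "(einstein M A g D \<longrightarrow>
       (\<forall>W e p i j. orthonormal_frame M A g W e \<longrightarrow> p \<in> W \<longrightarrow>
         (let R = curv_comp M A g D e p; \<tau> = scalar_curv M A g D e p in
           4 * \<tau> * R_bar R i j + 12 * R_check R i j + 12 * R_hat R i j - 24 * R_ring R i j
             = (\<tau> * norm_sq R - 4 * R_ring_scalar R + 2 * R_hat_scalar R) * g p (e i p) (e j p)))) \<and>
     (super_einstein M A g D \<longrightarrow>
       (\<forall>W e p i j. orthonormal_frame M A g W e \<longrightarrow> p \<in> W \<longrightarrow>
         (let R = curv_comp M A g D e p in
           2 * R_ring R i j - R_hat R i j
             = 1 / 6 * (2 * R_ring_scalar R - R_hat_scalar R) * g p (e i p) (e j p))))"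
proof -
  interpret levi_civita M A g D by fact
  have a: "4 * \<tau> * R_bar R i j + 12 * R_check R i j + 12 * R_hat R i j - 24 * R_ring R i j
      = (\<tau> * norm_sq R - 4 * R_ring_scalar R + 2 * R_hat_scalar R) * g p (e i p) (e j p)"
    if E: "einstein M A g D" and frame: "orthonormal_frame M A g W e" and p: "p \<in> W"
      and R: "R = curv_comp M A g D e p" and \<tau>: "\<tau> = scalar_curv M A g D e p" for W e p i j R \<tau>
  proof -
    have "g p (e i p) (e j p) = (if i = j then 1 else 0)"
      using frame p by (simp add: orthonormal_frame_def)
    moreover have "24 * (\<tau> / 6) * R_bar R i j + 12 * R_check R i j + 12 * R_hat R i j - 24 * R_ring R i j
        = (if i = j then 6 * (\<tau> / 6) * norm_sq R - 4 * R_ring_scalar R + 2 * R_hat_scalar R else 0)"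
      using einstein_curv_comp_trace[OF E frame p] curv_comp_algebraic[OF frame p]
      by (intro einstein_tensor_identity) (simp_all add: R \<tau>)
    ultimately show ?thesis by simp
  qed
  have b: "2 * R_ring R i j - R_hat R i j = 1 / 6 * (2 * R_ring_scalar R - R_hat_scalar R) * g p (e i p) (e j p)"
    if SE: "super_einstein M A g D" and frame: "orthonormal_frame M A g W e" and p: "p \<in> W"
      and R: "R = curv_comp M A g D e p" for W e p i j R
  proof -
    define \<tau> where "\<tau> = scalar_curv M A g D e p"
    interpret R: algebraic_curvature R
      unfolding R by (rule curv_comp_algebraic[OF frame p])
    have E: "einstein M A g D" using SE by (simp add: super_einstein_def)
    have orth: "g p (e i p) (e j p) = (if i = j then 1 else 0)" for i j
      using frame p by (simp add: orthonormal_frame_def)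
    have bar: "R_bar R i j = (if i = j then norm_sq R / 6 else 0)" for i j
    proof -
      have "R_bar R i j = norm_sq R / real CARD(6) * g p (e i p) (e j p)"
        using SE frame p unfolding R super_einstein_def by blast
      then show ?thesis by (cases "i = j") (simp_all add: orth)
    qed
    have "R_check R i j = (if i = j then \<tau> / 6 * (norm_sq R / 6) else 0)"
      by (rule R.super_einstein_check[OF _ bar]) (simp add: R \<tau>_def einstein_curv_comp_trace[OF E frame p])
    \<comment> \<open>In (a) the terms with \<open>R_bar\<close> and \<open>R_check\<close> now
      contribute 4/6 + 12/36 = 1 times \<open>\<tau> * norm_sq R\<close>, which cancels the same
      term on the right; division by -12 leaves (b).\<close>
    then show ?thesis
      using a[OF E frame p R \<tau>_def, of i j] by (simp add: bar orth split: if_splits)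
  qed
  show ?thesis
    unfolding Let_def using a b by blast
qed

end
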